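(* Let $C$ be a hyperelliptic curve of genus $g\ge2$ over a local field $K$ of odd residue characteristic that does not have potentially good reduction. Then for every integer $n$ with $1\le n\le n_{T_C,I_C}$, $$\mathrm{ord}(\mathrm{Inv}_{T_C,I_C,n}(C))=-2\sum_{m=1}^{n}K_m(C)\,(n+1-m)\,\delta_m(C).$$
   Context: $\mathrm{ord}$ is the valuation on $\bar K$ extending the normalised valuation of $K$. $C:y^2=f(x)$ with $f\in K[x]$ squarefree of degree $d=2g+2$, roots $x_1,\dots,x_d$, $\mathcal R=\{x_1,\dots,x_d\}$. Clusters: nonempty $\mathfrak s\subseteq\mathcal R$ of the form $\mathcal R\cap\{x:\mathrm{ord}(x-z)\ge r\}$; proper if $|\mathfrak s|>1$; depth $d_{\mathfrak s}=\min_{r,r'\in\mathfrak s}\mathrm{ord}(r-r')$; parent $P(\mathfrak s)$ = smallest cluster strictly containing $\mathfrak s\ne\mathcal R$; $\delta_{\mathfrak s}=d_{\mathfrak s}-d_{P(\mathfrak s)}$. Stable model tree $T_C$: vertex $v_{\mathfrak s}$ per cluster (including singletons); for $\mathfrak s\ne\mathcal R$ an edge $v_{\mathfrak s}v_{P(\mathfrak s)}$ of length $\delta_{\mathfrak s}$ if $\mathfrak s$ proper, no length if singleton. If $\mathcal R$ is the disjoint union of exactly two children $\mathfrak s_1,\mathfrak s_2$, remove $v_{\mathcal R}$ and join $v_{\mathfrak s_1},v_{\mathfrak s_2}$ by one edge of length $\delta_{\mathfrak s_1}+\delta_{\mathfrak s_2}$ if both proper (no length otherwise). $s_i$ = vertex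 of $\{x_i\}$ (singletons); other vertices proper; $\delta(v,w)$ = sum of lengths along the path between proper vertices. $C_{ij}$ is the path from $s_i$ to $s_j$; for distinct $i,j,k,l$ with $C_{ij},C_{kl}$ vertex-disjoint, $\delta(C_{ij},C_{kl})=\delta(v,w)$ where $v\in C_{ij},w\in C_{kl}$ are the endpoints of the shortest path joining them. $\delta_m(C)$ = $m$-th largest distinct value of $\delta(v,w)$, $v\ne w$ proper; $I_C$ = the total preorder on unordered pairs of distinct proper vertices induced by $\delta$; $n_{T_C,I_C}$ = number of distinct values. $S_m$ = set of unordered pairs $\{\{s_i,s_j\},\{s_k,s_l\}\}$ with $i,j,k,l$ distinct, $C_{ij},C_{kl}$ vertex-disjoint and $\delta(C_{ij},C_{kl})=\delta_m(C)$; $K_m(C)=\#S_m$. $(ij,kl)=\frac{(X_i-X_k)(X_i-X_l)(X_j-X_k)(X_j-X_l)}{(X_i-X_j)^2(X_k-X_l)^2}$, $R_{T_C,I_C,n}=\prod_{m=1}^n\prod_{\{\{s_i,s_j\},\{s_k,s_l\}\}\in S_m}(ij,kl)^{n-m+1}$; $S_d$ acts by $X_i\mapsto X_{\sigma(i)}$; $\mathrm{Inv}_{T_C,I_C,n}$ is the sum of the distinct elements of the $S_d$-orbit of $R_{T_C,I_C,n}$, and $\mathrm{Inv}_{T_C,I_C,n}(C)$ its value at $(x_1,\dots,x_d)$. *)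

theory Defs
  imports
    "HOL-Algebra.Algebraic_Closure_Type"
    "HOL-Computational_Algebra.Computational_Algebra"
    "HOL-Combinatorics.Permutations"
    "HOL-Library.Poly_Mapping"
    "HOL-Library.Extended_Real"
begin

section \<open>Local fields\<close>

definition valuation :: "('a::field \<Rightarrow> ereal) \<Rightarrow> bool" where
  "valuation v \<longleftrightarrow>
     (\<forall>a. v a = \<infinity> \<longleftrightarrow> a = 0) \<and> (\<forall>a. v a \<noteq> -\<infinity>) \<and>
     (\<forall>a b. v (a * b) = v a + v b) \<and> (\<forall>a b. min (v a) (v b) \<le> v (a + b))"

definition normalised_discrete :: "('a::field \<Rightarrow> ereal) \<Rightarrow> bool" where
  "normalised_discrete v \<longleftrightarrow> v ` (UNIV - {0}) = range (\<lambda>k::int. ereal (of_int k))"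

definition valuation_complete :: "('a::field \<Rightarrow> ereal) \<Rightarrow> bool" where
  "valuation_complete v \<longleftrightarrow>
     (\<forall>s::nat \<Rightarrow> 'a.
        (\<forall>B::real. \<exists>N. \<forall>m\<ge>N. \<forall>n\<ge>N. ereal B \<le> v (s m - s n)) \<longrightarrow>
        (\<exists>l. \<forall>B::real. \<exists>N. \<forall>n\<ge>N. ereal B \<le> v (s n - l)))"

definition residue_field :: "('a::field \<Rightarrow> ereal) \<Rightarrow> 'a set set" where
  "residue_field v = {a. 0 \<le> v a} // {(a, b). 0 \<le> v a \<and> 0 \<le> v b \<and> 0 < v (a - b)}"

definition local_field :: "('a::field \<Rightarrow> ereal) \<Rightarrow> bool" where
  "local_field v \<longleftrightarrow>
     valuation v \<and> normalised_discrete v \<and> valuation_complete v \<and> finite (residue_field v)"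

definition residue_char :: "('a::field \<Rightarrow> ereal) \<Rightarrow> nat" where
  "residue_char v = (LEAST p. 0 < p \<and> 0 < v (of_nat p))"


section \<open>Potentially good reduction of \<open>y\<^sup>2 = f(x)\<close>\<close>

definition finite_extension :: "'k::field alg_closure set \<Rightarrow> bool" where
  "finite_extension L \<longleftrightarrow>
     range to_ac \<subseteq> L \<and>
     (\<forall>a\<in>L. \<forall>b\<in>L. a + b \<in> L \<and> a - b \<in> L \<and> a * b \<in> L \<and> a / b \<in> L) \<and>
     (\<exists>B. finite B \<and> L = {\<Sum>b\<in>B. to_ac (c b) * b |c. True})"

text \<open>
  The change of variables \<open>x = (a X + b) / (c X + e)\<close>, \<open>y = Y / (u (c X + e)\<^sup>g\<^sup>+\<^sup>1)\<close> turns
  \<open>y\<^sup>2 = f(x)\<close>, with \<open>f\<close> of degree at most \<open>N = 2 g + 2\<close>, into \<open>Y\<^sup>2 = h(X)\<close> for the following \<open>h\<close>.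
\<close>

definition weierstrass_change ::
    "nat \<Rightarrow> 'a::field poly \<Rightarrow> 'a \<Rightarrow> 'a \<Rightarrow> 'a \<Rightarrow> 'a \<Rightarrow> 'a \<Rightarrow> 'a poly" where
  "weierstrass_change N f a b c e u =
     smult (u\<^sup>2) (\<Sum>i\<le>N. smult (coeff f i) ([:b, a:] ^ i * [:e, c:] ^ (N - i)))"

text \<open>
  Jacobian criterion for the reduction of the affine curve \<open>y\<^sup>2 = h(x)\<close>. Points over the (algebraically
  closed) residue field are represented by lifts to the ring of integers.
\<close>

definition smooth_reduction :: "('a::field \<Rightarrow> ereal) \<Rightarrow> 'a poly \<Rightarrow> bool" where
  "smooth_reduction ord h \<longleftrightarrow>
     (\<forall>i. 0 \<le> ord (coeff h i)) \<and>
     \<not> (\<exists>x y. 0 \<le> ord x \<and> 0 \<le> ord y \<and>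
           0 < ord (y\<^sup>2 - poly h x) \<and> 0 < ord (2 * y) \<and> 0 < ord (poly (pderiv h) x))"

text \<open>
  In odd residue characteristic and genus at least 2, a smooth proper model over the ring of integers of
  a finite extension is, after a further finite extension, a smooth Weierstrass model, glued from \<open>Y\<^sup>2 = h(X)\<close> and the chart \<open>W\<^sup>2 = Z\<^sup>N h(1/Z)\<close> at infinity.
\<close>

definition potentially_good_reduction ::
    "('k::field alg_closure \<Rightarrow> ereal) \<Rightarrow> nat \<Rightarrow> 'k poly \<Rightarrow> bool" where
  "potentially_good_reduction ord g f \<longleftrightarrow>
     (\<exists>L a b c e u. finite_extension L \<and> {a, b, c, e, u} \<subseteq> L \<and> a * e - b * c \<noteq> 0 \<and> u \<noteq> 0 \<and>
        (let N = 2 * g + 2;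
             h = weierstrass_change N (map_poly to_ac f) a b c e u
         in smooth_reduction ord h \<and>
            smooth_reduction ord (\<Sum>i\<le>N. monom (coeff h (N - i)) i)))"


section \<open>Clusters\<close>

definition clusters :: "('a::field \<Rightarrow> ereal) \<Rightarrow> 'a set \<Rightarrow> 'a set set" where
  "clusters ord R = {s. s \<noteq> {} \<and> (\<exists>z (r::real). s = R \<inter> {x. ereal r \<le> ord (x - z)})}"

abbreviation proper :: "'a set \<Rightarrow> bool" where
  "proper s \<equiv> 1 < card s"

definition depth :: "('a::field \<Rightarrow> ereal) \<Rightarrow> 'a set \<Rightarrow> ereal" where
  "depth ord s = Min {ord (r - r') |r r'. r \<in> s \<and> r' \<in> s}"

definition parent :: "('a::field \<Rightarrow> ereal) \<Rightarrow> 'a set \<Rightarrow> 'a set \<Rightarrow> 'a set" where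
  "parent ord R s = (LEAST t. t \<in> clusters ord R \<and> s \<subset> t)"

definition rel_depth :: "('a::field \<Rightarrow> ereal) \<Rightarrow> 'a set \<Rightarrow> 'a set \<Rightarrow> real" where
  "rel_depth ord R s = real_of_ereal (depth ord s - depth ord (parent ord R s))"

definition top_children :: "('a::field \<Rightarrow> ereal) \<Rightarrow> 'a set \<Rightarrow> 'a set set" where
  "top_children ord R = {s \<in> clusters ord R. s \<noteq> R \<and> parent ord R s = R}"

definition top_split :: "('a::field \<Rightarrow> ereal) \<Rightarrow> 'a set \<Rightarrow> 'a set \<Rightarrow> 'a set \<Rightarrow> bool" where
  "top_split ord R s1 s2 \<longleftrightarrow>
     s1 \<in> top_children ord R \<and> s2 \<in> top_children ord R \<and> s1 \<inter> s2 = {} \<and> s1 \<union> s2 = R"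


section \<open>The stable model tree\<close>

definition tree_verts :: "('a::field \<Rightarrow> ereal) \<Rightarrow> 'a set \<Rightarrow> 'a set set" where
  "tree_verts ord R =
     (if \<exists>s1 s2. top_split ord R s1 s2 then clusters ord R - {R} else clusters ord R)"

definition tree_edges :: "('a::field \<Rightarrow> ereal) \<Rightarrow> 'a set \<Rightarrow> 'a set set set" where
  "tree_edges ord R =
     {{s, parent ord R s} |s. s \<in> clusters ord R \<and> s \<noteq> R \<and> parent ord R s \<in> tree_verts ord R} \<union>
     {{s1, s2} |s1 s2. top_split ord R s1 s2}"

text \<open>Edges at singletons have no length, which is rendered by \<^const>\<open>undefined\<close>.\<close>

definition edge_length :: "('a::field \<Rightarrow> ereal) \<Rightarrow> 'a set \<Rightarrow> 'a set \<Rightarrow> 'a set \<Rightarrow> real" where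
  "edge_length ord R s t =
     (if \<not> (proper s \<and> proper t) then undefined
      else if s \<noteq> R \<and> t = parent ord R s then rel_depth ord R s
      else if t \<noteq> R \<and> s = parent ord R t then rel_depth ord R t
      else rel_depth ord R s + rel_depth ord R t)"

definition is_path :: "'v set set \<Rightarrow> 'v \<Rightarrow> 'v list \<Rightarrow> 'v \<Rightarrow> bool" where
  "is_path E v p w \<longleftrightarrow>
     p \<noteq> [] \<and> hd p = v \<and> last p = w \<and> distinct p \<and> successively (\<lambda>a b. {a, b} \<in> E) p"

definition tree_path :: "('a::field \<Rightarrow> ereal) \<Rightarrow> 'a set \<Rightarrow> 'a set \<Rightarrow> 'a set \<Rightarrow> 'a set list" where
  "tree_path ord R v w = (THE p. is_path (tree_edges ord R) v p w)"

definition tree_dist :: "('a::field \<Rightarrow> ereal) \<Rightarrow> 'a set \<Rightarrow> 'a set \<Rightarrow> 'a set \<Rightarrow> real" where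
  "tree_dist ord R v w =
     (let p = tree_path ord R v w in sum_list (map2 (edge_length ord R) p (tl p)))"

definition leaf_path :: "('a::field \<Rightarrow> ereal) \<Rightarrow> nat \<Rightarrow> (nat \<Rightarrow> 'a) \<Rightarrow> nat \<Rightarrow> nat \<Rightarrow> 'a set set" where
  "leaf_path ord d x i j = set (tree_path ord (x ` {1..d}) {x i} {x j})"

text \<open>
  The shortest path joining two disjoint paths is taken with respect to the number of edges, as edges
  at singletons have no length.
\<close>

definition path_dist :: "('a::field \<Rightarrow> ereal) \<Rightarrow> 'a set \<Rightarrow> 'a set set \<Rightarrow> 'a set set \<Rightarrow> real" where
  "path_dist ord R A B =
     (THE D. \<exists>v\<in>A. \<exists>w\<in>B. D = tree_dist ord R v w \<and>
        (\<forall>v'\<in>A. \<forall>w'\<in>B. length (tree_path ord R v w) \<le> length (tree_path ord R v' w')))"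

definition dist_values :: "('a::field \<Rightarrow> ereal) \<Rightarrow> nat \<Rightarrow> (nat \<Rightarrow> 'a) \<Rightarrow> real set" where
  "dist_values ord d x =
     (let R = x ` {1..d}
      in {tree_dist ord R v w |v w. v \<in> tree_verts ord R \<and> w \<in> tree_verts ord R \<and>
            proper v \<and> proper w \<and> v \<noteq> w})"

definition n_dist :: "('a::field \<Rightarrow> ereal) \<Rightarrow> nat \<Rightarrow> (nat \<Rightarrow> 'a) \<Rightarrow> nat" where
  "n_dist ord d x = card (dist_values ord d x)"

definition delta :: "('a::field \<Rightarrow> ereal) \<Rightarrow> nat \<Rightarrow> (nat \<Rightarrow> 'a) \<Rightarrow> nat \<Rightarrow> real" where
  "delta ord d x m = rev (sorted_list_of_set (dist_values ord d x)) ! (m - 1)"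

text \<open>The leaf \<open>s\<^sub>i = {x\<^sub>i}\<close> is represented by its index \<open>i\<close>.\<close>

definition S_pairs :: "('a::field \<Rightarrow> ereal) \<Rightarrow> nat \<Rightarrow> (nat \<Rightarrow> 'a) \<Rightarrow> nat \<Rightarrow> nat set set set" where
  "S_pairs ord d x m =
     {{{i, j}, {k, l}} |i j k l.
        {i, j, k, l} \<subseteq> {1..d} \<and> distinct [i, j, k, l] \<and>
        leaf_path ord d x i j \<inter> leaf_path ord d x k l = {} \<and>
        path_dist ord (x ` {1..d}) (leaf_path ord d x i j) (leaf_path ord d x k l) = delta ord d x m}"

definition K_count :: "('a::field \<Rightarrow> ereal) \<Rightarrow> nat \<Rightarrow> (nat \<Rightarrow> 'a) \<Rightarrow> nat \<Rightarrow> nat" where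
  "K_count ord d x m = card (S_pairs ord d x m)"


section \<open>Rational functions in \<open>X\<^sub>0, X\<^sub>1, X\<^sub>2, \<dots>\<close>\<close>

type_synonym int_mpoly = "(nat \<Rightarrow>\<^sub>0 nat) \<Rightarrow>\<^sub>0 int"

type_synonym ratfun = "int_mpoly fract"

definition X_var :: "nat \<Rightarrow> ratfun" where
  "X_var i = Fract (Poly_Mapping.single (Poly_Mapping.single i 1) 1) 1"

definition mpoly_eval :: "(nat \<Rightarrow> 'b::comm_ring_1) \<Rightarrow> int_mpoly \<Rightarrow> 'b" where
  "mpoly_eval \<phi> p =
     (\<Sum>m\<in>Poly_Mapping.keys p. of_int (Poly_Mapping.lookup p m) *
        (\<Prod>i\<in>Poly_Mapping.keys m. \<phi> i ^ Poly_Mapping.lookup m i))"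

text \<open>Independent of the representation of \<open>r\<close> as a fraction whose denominator does not vanish at \<open>\<phi>\<close>.\<close>

definition ratfun_eval :: "(nat \<Rightarrow> 'b::field) \<Rightarrow> ratfun \<Rightarrow> 'b" where
  "ratfun_eval \<phi> r =
     (THE z. \<exists>p q. r = Fract p q \<and> mpoly_eval \<phi> q \<noteq> 0 \<and> z = mpoly_eval \<phi> p / mpoly_eval \<phi> q)"

definition perm_act :: "(nat \<Rightarrow> nat) \<Rightarrow> ratfun \<Rightarrow> ratfun" where
  "perm_act \<sigma> r = ratfun_eval (\<lambda>i. X_var (\<sigma> i)) r"

definition cross :: "nat \<Rightarrow> nat \<Rightarrow> nat \<Rightarrow> nat \<Rightarrow> ratfun" where
  "cross i j k l =
     (X_var i - X_var k) * (X_var i - X_var l) * (X_var j - X_var k) * (X_var j - X_var l) /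
     ((X_var i - X_var j)\<^sup>2 * (X_var k - X_var l)\<^sup>2)"

text \<open>\<^const>\<open>cross\<close> is invariant under swapping \<open>i, j\<close>, swapping \<open>k, l\<close>, and swapping the two pairs.\<close>

definition cross_pair :: "nat set set \<Rightarrow> ratfun" where
  "cross_pair P = (THE r. \<exists>i j k l. P = {{i, j}, {k, l}} \<and> r = cross i j k l)"


section \<open>The invariants\<close>

definition R_fun :: "('a::field \<Rightarrow> ereal) \<Rightarrow> nat \<Rightarrow> (nat \<Rightarrow> 'a) \<Rightarrow> nat \<Rightarrow> ratfun" where
  "R_fun ord d x n = (\<Prod>m=1..n. \<Prod>P\<in>S_pairs ord d x m. cross_pair P ^ (n - m + 1))"

definition Inv :: "('a::field \<Rightarrow> ereal) \<Rightarrow> nat \<Rightarrow> (nat \<Rightarrow> 'a) \<Rightarrow> nat \<Rightarrow> ratfun" where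
  "Inv ord d x n = \<Sum>{perm_act \<sigma> (R_fun ord d x n) |\<sigma>. \<sigma> permutes {1..d}}"

end

theory Submission
  imports Defs
begin

text \<open>
  For four distinct roots put \<open>A = ord(x\<^sub>i - x\<^sub>j) + ord(x\<^sub>k - x\<^sub>l)\<close>, and let \<open>B\<close>, \<open>C\<close> be the sums for the two
  other pairings, so that \<open>(ij,kl)\<close> has order \<open>B + C - 2 A\<close>. By the ultrametric inequality the two smallest
  of \<open>A\<close>, \<open>B\<close>, \<open>C\<close> agree. The paths \<open>C\<^sub>i\<^sub>j\<close> and \<open>C\<^sub>k\<^sub>l\<close> are disjoint exactly if \<open>A\<close> is strictly the largest, and
  then their distance is \<open>A - B\<close>; thus \<open>(ij,kl)\<close> has order \<open>- 2 \<delta>(C\<^sub>i\<^sub>j, C\<^sub>k\<^sub>l)\<close> if the paths are disjoint and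
  nonnegative order otherwise.

  The order of \<open>R\<^sub>n\<close> is the sum over \<open>k \<le> n\<close> of the orders of all \<open>(ij,kl)\<close> in \<open>S\<^sub>1 \<union> \<dots> \<union> S\<^sub>k\<close>, which is the set
  of all pairs of order at most \<open>- 2 \<delta>\<^sub>k\<close>. A permutation replaces this sublevel set by another set of the
  same size, so each summand strictly increases unless the sublevel set is preserved. If all of them are
  preserved, \<open>R\<^sub>n\<close> is fixed. Hence \<open>R\<^sub>n\<close> is the unique element of least order in its orbit.
\<close>

section \<open>Evaluation of rational functions\<close>

definition mono_eval :: "(nat \<Rightarrow> 'b::comm_ring_1) \<Rightarrow> (nat \<Rightarrow>\<^sub>0 nat) \<Rightarrow> 'b" where
  "mono_eval \<phi> m = (\<Prod>i\<in>Poly_Mapping.keys m. \<phi> i ^ Poly_Mapping.lookup m i)"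

text \<open>Extra indices contribute factors with exponent \<open>0\<close>. A common index set lets
  monomials with different supports be compared.\<close>

lemma mono_eval_superset:
  assumes "finite A" "Poly_Mapping.keys m \<subseteq> A"
  shows "mono_eval \<phi> m = (\<Prod>i\<in>A. \<phi> i ^ Poly_Mapping.lookup m i)"
  unfolding mono_eval_def
  by (rule prod.mono_neutral_left) (use assms in \<open>auto simp: in_keys_iff\<close>)

lemma mono_eval_add: "mono_eval \<phi> (m + n) = mono_eval \<phi> m * mono_eval \<phi> n"
proof -
  let ?A = "Poly_Mapping.keys m \<union> Poly_Mapping.keys n"
  have "Poly_Mapping.keys (m + n) \<subseteq> ?A" by (rule Poly_Mapping.keys_add)
  then show ?thesis
    by (simp add: mono_eval_superset[of ?A] lookup_add power_add prod.distrib)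
qed

lemma mpoly_eval_superset:
  assumes "finite A" "Poly_Mapping.keys p \<subseteq> A"
  shows "mpoly_eval \<phi> p = (\<Sum>m\<in>A. of_int (Poly_Mapping.lookup p m) * mono_eval \<phi> m)"
  unfolding mpoly_eval_def mono_eval_def[symmetric]
  by (rule sum.mono_neutral_left) (use assms in \<open>auto simp: in_keys_iff\<close>)

lemma mpoly_eval_0 [simp]: "mpoly_eval \<phi> 0 = 0"
  by (simp add: mpoly_eval_def)

lemma mpoly_eval_monomial: "mpoly_eval \<phi> (Poly_Mapping.single m c) = of_int c * mono_eval \<phi> m"
  using mpoly_eval_superset[of "{m}" "Poly_Mapping.single m c" \<phi>] by simp

lemma mpoly_eval_1 [simp]: "mpoly_eval \<phi> 1 = 1"
  using mpoly_eval_monomial[of \<phi> 0 1] by (simp add: mono_eval_def)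

lemma mpoly_eval_diff: "mpoly_eval \<phi> (p - q) = mpoly_eval \<phi> p - mpoly_eval \<phi> q"
proof -
  let ?A = "Poly_Mapping.keys p \<union> Poly_Mapping.keys q"
  have "Poly_Mapping.keys (p - q) \<subseteq> ?A" by (rule keys_diff)
  then show ?thesis
    by (simp add: mpoly_eval_superset[of ?A] lookup_minus algebra_simps sum_subtractf)
qed

lemma mpoly_eval_add: "mpoly_eval \<phi> (p + q) = mpoly_eval \<phi> p + mpoly_eval \<phi> q"
  using mpoly_eval_diff[of \<phi> "p + q" q] by simp

text \<open>Both sides are additive in each factor, so monomials suffice: integer polynomials form
  the free abelian group on exponent vectors, and \<open>frag_induction\<close> generates it from
  the \<open>frag_of m\<close> by differences.\<close>

lemma mpoly_eval_mult: "mpoly_eval \<phi> (p * q) = mpoly_eval \<phi> p * mpoly_eval \<phi> q"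
proof -
  have one: "mpoly_eval \<phi> (frag_of m * q) = mpoly_eval \<phi> (frag_of m) * mpoly_eval \<phi> q" for m
  proof (rule frag_induction[of q UNIV])
    fix n
    show "mpoly_eval \<phi> (frag_of m * frag_of n) = mpoly_eval \<phi> (frag_of m) * mpoly_eval \<phi> (frag_of n)"
      by (simp add: mult_single mpoly_eval_monomial mono_eval_add)
  qed (simp_all add: mpoly_eval_diff algebra_simps)
  show ?thesis
    by (rule frag_induction[of p UNIV]) (simp_all add: one mpoly_eval_diff left_diff_distrib)
qed

section \<open>Evaluation of fractions with a denominator that does not vanish\<close>

definition regular_at :: "(nat \<Rightarrow> 'b::field) \<Rightarrow> ratfun \<Rightarrow> bool" where
  "regular_at \<phi> r \<longleftrightarrow> (\<exists>p q. r = Fract p q \<and> mpoly_eval \<phi> q \<noteq> 0)"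

text \<open>Equal fractions agree after cross-multiplication, and \<open>mpoly_eval\<close> is
  multiplicative, so every admissible representation yields the same quotient. This makes the
  \<open>THE\<close> in \<open>ratfun_eval\<close> denote.\<close>

lemma ratfun_eval_Fract:
  assumes "mpoly_eval \<phi> q \<noteq> 0"
  shows "ratfun_eval \<phi> (Fract p q) = mpoly_eval \<phi> p / mpoly_eval \<phi> q"
  unfolding ratfun_eval_def
proof (rule the_equality)
  fix z
  assume "\<exists>p' q'. Fract p q = Fract p' q' \<and> mpoly_eval \<phi> q' \<noteq> 0 \<and> z = mpoly_eval \<phi> p' / mpoly_eval \<phi> q'"
  then obtain p' q' where *: "Fract p q = Fract p' q'" "mpoly_eval \<phi> q' \<noteq> 0"
    "z = mpoly_eval \<phi> p' / mpoly_eval \<phi> q'" by blast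
  have "q \<noteq> 0" "q' \<noteq> 0" using assms *(2) by auto
  then have "p * q' = p' * q" using *(1) by (simp add: eq_fract)
  then have "mpoly_eval \<phi> p * mpoly_eval \<phi> q' = mpoly_eval \<phi> p' * mpoly_eval \<phi> q"
    by (metis mpoly_eval_mult)
  then show "z = mpoly_eval \<phi> p / mpoly_eval \<phi> q"
    using assms * by (simp add: frac_eq_eq)
qed (use assms in blast)

lemma regular_atE:
  assumes "regular_at \<phi> r"
  obtains p q where "r = Fract p q" "q \<noteq> 0" "mpoly_eval \<phi> q \<noteq> 0"
    "ratfun_eval \<phi> r = mpoly_eval \<phi> p / mpoly_eval \<phi> q"
  using assms by (metis regular_at_def ratfun_eval_Fract mpoly_eval_0)

lemma regular_at_Fract: "mpoly_eval \<phi> q \<noteq> 0 \<Longrightarrow> regular_at \<phi> (Fract p q)"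
  by (auto simp: regular_at_def)

lemma ratfun_eval_add:
  assumes "regular_at \<phi> r" "regular_at \<phi> s"
  shows "regular_at \<phi> (r + s)" "ratfun_eval \<phi> (r + s) = ratfun_eval \<phi> r + ratfun_eval \<phi> s"
  using assms
  by (auto elim!: regular_atE intro!: regular_at_Fract
      simp: ratfun_eval_Fract mpoly_eval_mult mpoly_eval_add add_frac_eq)

lemma ratfun_eval_diff:
  assumes "regular_at \<phi> r" "regular_at \<phi> s"
  shows "regular_at \<phi> (r - s)" "ratfun_eval \<phi> (r - s) = ratfun_eval \<phi> r - ratfun_eval \<phi> s"
  using assms
  by (auto elim!: regular_atE intro!: regular_at_Fract
      simp: ratfun_eval_Fract mpoly_eval_mult mpoly_eval_diff diff_frac_eq)

lemma ratfun_eval_mult: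
  assumes "regular_at \<phi> r" "regular_at \<phi> s"
  shows "regular_at \<phi> (r * s)" "ratfun_eval \<phi> (r * s) = ratfun_eval \<phi> r * ratfun_eval \<phi> s"
  using assms
  by (auto elim!: regular_atE intro!: regular_at_Fract simp: ratfun_eval_Fract mpoly_eval_mult)

lemma ratfun_eval_divide:
  assumes "regular_at \<phi> r" "regular_at \<phi> s" "ratfun_eval \<phi> s \<noteq> 0"
  shows "regular_at \<phi> (r / s)" "ratfun_eval \<phi> (r / s) = ratfun_eval \<phi> r / ratfun_eval \<phi> s"
  using assms
  by (auto elim!: regular_atE intro!: regular_at_Fract simp: ratfun_eval_Fract mpoly_eval_mult)

lemma ratfun_eval_const:
  shows "regular_at \<phi> 0" "ratfun_eval \<phi> 0 = 0" "regular_at \<phi> 1" "ratfun_eval \<phi> 1 = 1"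
  by (simp_all add: Zero_fract_def One_fract_def ratfun_eval_Fract regular_at_Fract)

lemma ratfun_eval_power:
  assumes "regular_at \<phi> r"
  shows "regular_at \<phi> (r ^ n)" "ratfun_eval \<phi> (r ^ n) = ratfun_eval \<phi> r ^ n"
  using assms by (induction n) (simp_all add: ratfun_eval_const ratfun_eval_mult)

lemma ratfun_eval_prod:
  assumes "\<And>a. a \<in> A \<Longrightarrow> regular_at \<phi> (h a)"
  shows "regular_at \<phi> (\<Prod>a\<in>A. h a)" "ratfun_eval \<phi> (\<Prod>a\<in>A. h a) = (\<Prod>a\<in>A. ratfun_eval \<phi> (h a))"
  using assms
  by (induction A rule: infinite_finite_induct) (simp_all add: ratfun_eval_const ratfun_eval_mult)

lemma ratfun_eval_sum:
  assumes "\<And>a. a \<in> A \<Longrightarrow> regular_at \<phi> (h a)"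
  shows "regular_at \<phi> (\<Sum>a\<in>A. h a)" "ratfun_eval \<phi> (\<Sum>a\<in>A. h a) = (\<Sum>a\<in>A. ratfun_eval \<phi> (h a))"
  using assms
  by (induction A rule: infinite_finite_induct) (simp_all add: ratfun_eval_const ratfun_eval_add)

text \<open>The shape of \<open>R_fun\<close>, where a level \<open>m\<close> carries one exponent
  \<open>e m\<close> for all its factors. It serves both for values at the roots and for
  substitution of permuted variables.\<close>

lemma ratfun_eval_prod_power:
  assumes "\<And>m P. m \<in> M \<Longrightarrow> P \<in> S m \<Longrightarrow> regular_at \<phi> (h P)"
  shows "regular_at \<phi> (\<Prod>m\<in>M. \<Prod>P\<in>S m. h P ^ e m)"
    "ratfun_eval \<phi> (\<Prod>m\<in>M. \<Prod>P\<in>S m. h P ^ e m) = (\<Prod>m\<in>M. \<Prod>P\<in>S m. ratfun_eval \<phi> (h P) ^ e m)"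
proof -
  have inner: "regular_at \<phi> (\<Prod>P\<in>S m. h P ^ e m)"
    "ratfun_eval \<phi> (\<Prod>P\<in>S m. h P ^ e m) = (\<Prod>P\<in>S m. ratfun_eval \<phi> (h P) ^ e m)" if "m \<in> M" for m
  proof -
    note reg = assms[OF that]
    show "regular_at \<phi> (\<Prod>P\<in>S m. h P ^ e m)" by (intro ratfun_eval_prod(1) ratfun_eval_power(1) reg)
    have "ratfun_eval \<phi> (\<Prod>P\<in>S m. h P ^ e m) = (\<Prod>P\<in>S m. ratfun_eval \<phi> (h P ^ e m))"
      by (intro ratfun_eval_prod(2) ratfun_eval_power(1) reg)
    also have "\<dots> = (\<Prod>P\<in>S m. ratfun_eval \<phi> (h P) ^ e m)"
      by (intro prod.cong refl ratfun_eval_power(2) reg)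
    finally show "ratfun_eval \<phi> (\<Prod>P\<in>S m. h P ^ e m) = (\<Prod>P\<in>S m. ratfun_eval \<phi> (h P) ^ e m)" .
  qed
  show "regular_at \<phi> (\<Prod>m\<in>M. \<Prod>P\<in>S m. h P ^ e m)" by (intro ratfun_eval_prod(1) inner(1))
  have "ratfun_eval \<phi> (\<Prod>m\<in>M. \<Prod>P\<in>S m. h P ^ e m) = (\<Prod>m\<in>M. ratfun_eval \<phi> (\<Prod>P\<in>S m. h P ^ e m))"
    by (intro ratfun_eval_prod(2) inner(1))
  also have "\<dots> = (\<Prod>m\<in>M. \<Prod>P\<in>S m. ratfun_eval \<phi> (h P) ^ e m)"
    by (intro prod.cong refl inner(2))
  finally show "ratfun_eval \<phi> (\<Prod>m\<in>M. \<Prod>P\<in>S m. h P ^ e m) =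
      (\<Prod>m\<in>M. \<Prod>P\<in>S m. ratfun_eval \<phi> (h P) ^ e m)" .
qed

lemma ratfun_eval_X_var:
  shows "regular_at \<phi> (X_var i)" "ratfun_eval \<phi> (X_var i) = \<phi> i"
  by (simp_all add: X_var_def ratfun_eval_Fract regular_at_Fract mpoly_eval_monomial mono_eval_def)

lemma inj_X_var: "inj X_var"
proof (rule injI)
  fix i j assume "X_var i = X_var j"
  then have "Poly_Mapping.single (Poly_Mapping.single i (1::nat)) (1::int) =
      Poly_Mapping.single (Poly_Mapping.single j 1) 1"
    by (simp add: X_var_def eq_fract)
  then show "i = j"
    by (metis keys_single singleton_inject zero_neq_one)
qed

section \<open>The factors \<open>(ij,kl)\<close> and the action of permutations on them\<close>

definition cross_value :: "'b::field \<Rightarrow> 'b \<Rightarrow> 'b \<Rightarrow> 'b \<Rightarrow> 'b" where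
  "cross_value a b c e =
     (a - c) * (a - e) * (b - c) * (b - e) / ((a - b)\<^sup>2 * (c - e)\<^sup>2)"

text \<open>The target field is arbitrary: the roots as \<open>\<phi>\<close> give numerical values,
  permuted variables in \<open>ratfun\<close> give the action of a permutation.\<close>

lemma ratfun_eval_cross:
  assumes "\<phi> i \<noteq> \<phi> j" "\<phi> k \<noteq> \<phi> l"
  shows "regular_at \<phi> (cross i j k l)"
    "ratfun_eval \<phi> (cross i j k l) = cross_value (\<phi> i) (\<phi> j) (\<phi> k) (\<phi> l)"
  unfolding cross_def cross_value_def using assms
  by (simp_all add: ratfun_eval_X_var ratfun_eval_diff ratfun_eval_mult ratfun_eval_power ratfun_eval_divide)

text \<open>The \<open>THE\<close> denotes because the eight orderings of the indices that describe
  the same pair of pairs all give the same \<open>cross\<close>.\<close>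

lemma cross_pair_eq:
  assumes "distinct [i, j, k, l]"
  shows "cross_pair {{i, j}, {k, l}} = cross i j k l"
  unfolding cross_pair_def
proof (rule the_equality)
  fix r assume "\<exists>i' j' k' l'. {{i, j}, {k, l}} = {{i', j'}, {k', l'}} \<and> r = cross i' j' k' l'"
  then obtain i' j' k' l' where *: "{{i, j}, {k, l}} = {{i', j'}, {k', l'}}" "r = cross i' j' k' l'"
    by blast
  then have "({i, j} = {i', j'} \<and> {k, l} = {k', l'}) \<or> ({i, j} = {k', l'} \<and> {k, l} = {i', j'})"
    by (simp add: doubleton_eq_iff[of "{i, j}"])
  then show "r = cross i j k l"
    using *(2)
    by (auto simp: doubleton_eq_iff cross_def power2_commute mult_ac)
      (simp_all add: field_simps power2_eq_square)
qed blast

text \<open>A finite set, stable under permutations, that contains every \<open>S_pairs\<close>;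
  sublevel sets are compared inside it.\<close>

definition quads :: "nat \<Rightarrow> nat set set set" where
  "quads d = {{{i, j}, {k, l}} |i j k l. {i, j, k, l} \<subseteq> {1..d} \<and> distinct [i, j, k, l]}"

lemma finite_quads: "finite (quads d)"
proof (rule finite_subset)
  show "quads d \<subseteq> Pow (Pow {1..d})" by (auto simp: quads_def)
qed simp

text \<open>The substituted variables \<open>X_var (\<sigma> i)\<close> are pairwise distinct, so no
  denominator vanishes and the substitution only relabels the indices.\<close>

lemma perm_act_cross_pair:
  assumes "\<sigma> permutes {1..d}" "P \<in> quads d"
  shows "regular_at (\<lambda>i. X_var (\<sigma> i)) (cross_pair P)"
    "perm_act \<sigma> (cross_pair P) = cross_pair ((`) ((`) \<sigma>) P)"
    "(`) ((`) \<sigma>) P \<in> quads d"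
proof -
  obtain i j k l where P: "P = {{i, j}, {k, l}}" "{i, j, k, l} \<subseteq> {1..d}" "distinct [i, j, k, l]"
    using assms(2) by (auto simp: quads_def)
  have inj: "\<sigma> a = \<sigma> b \<longleftrightarrow> a = b" for a b
    using permutes_inj[OF assms(1)] by (auto dest: injD)
  have inj': "X_var (\<sigma> a) = X_var (\<sigma> b) \<longleftrightarrow> a = b" for a b
    using inj inj_X_var by (auto dest: injD)
  have d': "distinct [\<sigma> i, \<sigma> j, \<sigma> k, \<sigma> l]" using P(3) by (simp add: inj)
  have img: "(`) ((`) \<sigma>) P = {{\<sigma> i, \<sigma> j}, {\<sigma> k, \<sigma> l}}" by (simp add: P)
  have "\<sigma> a \<in> {1..d}" if "a \<in> {1..d}" for a using assms(1) that by (simp only: permutes_in_image)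
  then have "{\<sigma> i, \<sigma> j, \<sigma> k, \<sigma> l} \<subseteq> {1..d}" using P(2) by blast
  then show "(`) ((`) \<sigma>) P \<in> quads d" unfolding img quads_def using d' by blast
  have eq: "cross_pair P = cross i j k l" "cross_pair ((`) ((`) \<sigma>) P) = cross (\<sigma> i) (\<sigma> j) (\<sigma> k) (\<sigma> l)"
    unfolding img unfolding P(1) using cross_pair_eq[OF P(3)] cross_pair_eq[OF d'] by simp_all
  show "regular_at (\<lambda>i. X_var (\<sigma> i)) (cross_pair P)"
    unfolding eq by (rule ratfun_eval_cross) (use P(3) in \<open>auto simp: inj'\<close>)
  show "perm_act \<sigma> (cross_pair P) = cross_pair ((`) ((`) \<sigma>) P)"
    unfolding eq perm_act_def
    by (subst ratfun_eval_cross) (use P(3) in \<open>auto simp: inj' cross_def cross_value_def\<close>)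
qed

section \<open>Clusters and the stable model tree\<close>

locale root_set =
  fixes ord :: "'a::field \<Rightarrow> ereal" and R :: "'a set"
  assumes val: "valuation ord" and fin: "finite R" and nonempty: "R \<noteq> {}"
begin

section \<open>Arithmetic of the valuation\<close>

lemma ord_0_iff: "ord a = \<infinity> \<longleftrightarrow> a = 0"
  and ord_not_MInf: "ord a \<noteq> -\<infinity>"
  and ord_mult: "ord (a * b) = ord a + ord b"
  and ord_add: "min (ord a) (ord b) \<le> ord (a + b)"
  using val by (auto simp: valuation_def)

text \<open>A real-valued copy of \<open>ord\<close>, open to linear arithmetic. At
  \<open>0\<close>, where \<open>ord\<close> is infinite, it takes the default value
  \<open>0\<close>.\<close>

definition rord :: "'a \<Rightarrow> real" where
  "rord a = real_of_ereal (ord a)"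

lemma ord_eq: "a \<noteq> 0 \<Longrightarrow> ord a = ereal (rord a)"
  using ord_0_iff[of a] ord_not_MInf[of a] by (cases "ord a") (auto simp: rord_def)

lemma rord_mult: "a \<noteq> 0 \<Longrightarrow> b \<noteq> 0 \<Longrightarrow> rord (a * b) = rord a + rord b"
  using ord_mult[of a b] by (simp add: ord_eq)

lemma rord_1 [simp]: "rord 1 = 0"
  using rord_mult[of 1 1] by simp

lemma rord_divide: "a \<noteq> 0 \<Longrightarrow> b \<noteq> 0 \<Longrightarrow> rord (a / b) = rord a - rord b"
  using rord_mult[of "a / b" b] by simp

lemma rord_power: "a \<noteq> 0 \<Longrightarrow> rord (a ^ n) = real n * rord a"
  by (induction n) (simp_all add: rord_mult algebra_simps)

lemma rord_prod: "(\<And>a. a \<in> A \<Longrightarrow> h a \<noteq> 0) \<Longrightarrow> rord (\<Prod>a\<in>A. h a) = (\<Sum>a\<in>A. rord (h a))"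
  by (induction A rule: infinite_finite_induct) (simp_all add: rord_mult)

lemma rord_minus [simp]: "rord (- a) = rord a"
proof (cases "a = 0")
  case False
  \<comment> \<open>The square of \<open>-1\<close> is \<open>1\<close>, so twice the order of
    \<open>-1\<close> is \<open>0\<close>.\<close>
  have "rord (-1 * -1) = rord (-1) + rord (-1)" by (rule rord_mult) simp_all
  then have "rord (-1) = 0" by simp
  then show ?thesis using rord_mult[of "-1" a] False by simp
qed simp

lemma ord_minus [simp]: "ord (- a) = ord a"
  by (cases "a = 0") (simp_all add: ord_eq)

lemma ord_minus_commute: "ord (a - b) = ord (b - a)"
  using ord_minus[of "a - b"] by simp

lemma rord_minus_commute: "rord (a - b) = rord (b - a)"
  using rord_minus[of "a - b"] by simp

lemma ord_diff_trans: "r \<le> ord (a - b) \<Longrightarrow> r \<le> ord (b - c) \<Longrightarrow> r \<le> ord (a - c)"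
  using order_trans[of r "min (ord (a - b)) (ord (b - c))" "ord (a - c)"] ord_add[of "a - b" "b - c"]
  by simp

lemma ord_0 [simp]: "ord 0 = \<infinity>"
  by (simp add: ord_0_iff)

lemma ord_sum_greater:
  assumes "\<And>y. y \<in> Y \<Longrightarrow> ereal r < ord (h y)"
  shows "ereal r < ord (\<Sum>y\<in>Y. h y)"
  using assms
proof (induction Y rule: infinite_finite_induct)
  case (insert a Y)
  then have "ereal r < min (ord (h a)) (ord (\<Sum>y\<in>Y. h y))" by simp
  also have "\<dots> \<le> ord (\<Sum>y\<in>insert a Y. h y)" using ord_add insert by simp
  finally show ?case .
qed auto

text \<open>The other terms sum to a \<open>t\<close> of strictly larger order. The ultrametric
  inequality for \<open>h y + t\<close> gives one bound, the one for
  \<open>h y = (h y + t) - t\<close> the other.\<close>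

lemma ord_sum_unique_min:
  assumes "finite Y" "y \<in> Y" "h y \<noteq> 0" "\<And>z. z \<in> Y \<Longrightarrow> z \<noteq> y \<Longrightarrow> h z \<noteq> 0 \<and> rord (h y) < rord (h z)"
  shows "ord (\<Sum>z\<in>Y. h z) = ereal (rord (h y))"
proof -
  define t where "t = (\<Sum>z\<in>Y - {y}. h z)"
  have t: "ereal (rord (h y)) < ord t"
    unfolding t_def by (rule ord_sum_greater) (use assms(4) in \<open>auto simp: ord_eq\<close>)
  have eq: "(\<Sum>z\<in>Y. h z) = h y + t" unfolding t_def using assms by (simp add: sum.remove)
  have "min (ord (h y)) (ord t) \<le> ord (h y + t)" by (rule ord_add)
  moreover have "min (ord (h y + t)) (ord (- t)) \<le> ord (h y)" using ord_add[of "h y + t" "- t"] by simp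
  ultimately show ?thesis
    unfolding eq using t assms(3) by (auto simp: ord_eq min_def split: if_splits)
qed

section \<open>Clusters as ultrametric balls; joins, depths and parents\<close>

abbreviation "CC \<equiv> clusters ord R"

lemma cluster_subset: "s \<in> CC \<Longrightarrow> s \<subseteq> R"
  and cluster_nonempty: "s \<in> CC \<Longrightarrow> s \<noteq> {}"
  by (auto simp: clusters_def)

lemma finite_cluster: "s \<in> CC \<Longrightarrow> finite s"
  using cluster_subset fin finite_subset by blast

lemma finite_clusters: "finite CC"
  by (rule finite_subset[of _ "Pow R"]) (use cluster_subset fin in auto)

text \<open>Every point of an ultrametric ball is a centre of it. The original centre
  \<open>z\<close> may lie outside \<open>R\<close>; the new radius serves all points of
  \<open>s\<close> at once.\<close>

lemma cluster_recenter:
  assumes "s \<in> CC"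
  obtains r :: real where "\<And>a. a \<in> s \<Longrightarrow> s = {b \<in> R. ereal r \<le> ord (b - a)}"
proof -
  obtain z r where s: "s = R \<inter> {b. ereal r \<le> ord (b - z)}" using assms by (auto simp: clusters_def)
  have "s = {b \<in> R. ereal r \<le> ord (b - a)}" if "a \<in> s" for a
  proof -
    have "ereal r \<le> ord (a - z)" "ereal r \<le> ord (z - a)" using that s ord_minus_commute by auto
    then show ?thesis unfolding s using ord_diff_trans by blast
  qed
  then show thesis by (rule that)
qed

text \<open>Both balls can be centred at a common point, and then the one with the smaller bound on
  the order contains the other.\<close>

lemma laminar:
  assumes "s \<in> CC" "t \<in> CC" "s \<inter> t \<noteq> {}"
  shows "s \<subseteq> t \<or> t \<subseteq> s"
proof -
  obtain a where a: "a \<in> s" "a \<in> t" using assms(3) by blast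
  obtain r where r: "s = {b \<in> R. ereal r \<le> ord (b - a)}" using cluster_recenter[OF assms(1)] a by metis
  obtain r' where r': "t = {b \<in> R. ereal r' \<le> ord (b - a)}" using cluster_recenter[OF assms(2)] a by metis
  show ?thesis
  proof (cases "r \<le> r'")
    case True
    then have "t \<subseteq> s" unfolding r r' by (auto intro: order_trans[of "ereal r" "ereal r'"])
    then show ?thesis ..
  next
    case False
    then have "s \<subseteq> t" unfolding r r' by (auto intro: order_trans[of "ereal r'" "ereal r"])
    then show ?thesis ..
  qed
qed

lemma ball_cluster: "a \<in> R \<Longrightarrow> {b \<in> R. ereal r \<le> ord (b - a)} \<in> CC"
  unfolding clusters_def
  by (intro CollectI conjI exI[of _ a] exI[of _ r]) (auto intro: exI[of _ a])

lemma R_cluster: "R \<in> CC"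
proof -
  obtain a where a: "a \<in> R" using nonempty by blast
  \<comment> \<open>A bound below all orders of differences from \<open>a\<close>, so that the ball
    around \<open>a\<close> contains all of \<open>R\<close>.\<close>
  define r where "r = Min (insert 0 ((\<lambda>b. rord (b - a)) ` R))"
  have "ereal r \<le> ord (b - a)" if "b \<in> R" for b
  proof (cases "b = a")
    case False
    have "r \<le> rord (b - a)" unfolding r_def using that fin by simp
    then show ?thesis using False by (simp add: ord_eq)
  qed simp
  then have "R = {b \<in> R. ereal r \<le> ord (b - a)}" by blast
  then show ?thesis using ball_cluster[OF a, of r] by simp
qed

lemma singleton_cluster:
  assumes a: "a \<in> R" shows "{a} \<in> CC"
proof -
  \<comment> \<open>The \<open>+ 1\<close> pushes the bound beyond every order of a difference from
    \<open>a\<close>, so only \<open>a\<close> remains in the ball.\<close>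
  define r where "r = Max (insert 0 ((\<lambda>b. rord (b - a)) ` R)) + 1"
  have "\<not> ereal r \<le> ord (b - a)" if "b \<in> R" "b \<noteq> a" for b
  proof -
    have "rord (b - a) \<le> Max (insert 0 ((\<lambda>b. rord (b - a)) ` R))" using that fin by simp
    then show ?thesis using that by (simp add: ord_eq r_def)
  qed
  then have "{a} = {b \<in> R. ereal r \<le> ord (b - a)}" using a by auto
  then show ?thesis using ball_cluster[OF a, of r] by simp
qed

text \<open>The lowest common ancestor in the tree of all clusters, that is, before the root is
  possibly removed.\<close>

definition cjoin :: "'a set \<Rightarrow> 'a set \<Rightarrow> 'a set" where
  "cjoin v w = \<Inter>{t \<in> CC. v \<union> w \<subseteq> t}"

text \<open>Clusters through a common point form a finite chain by \<open>laminar\<close>, so their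
  intersection is the least of them. Joins and parents both exist for this reason.\<close>

lemma Inter_cluster:
  assumes "T \<subseteq> CC" "T \<noteq> {}" "\<Inter>T \<noteq> {}"
  shows "\<Inter>T \<in> T"
proof -
  have "finite T" by (rule finite_subset[OF assms(1) finite_clusters])
  from finite_has_minimal[OF this assms(2)]
  obtain t where t: "t \<in> T" "\<forall>s\<in>T. s \<le> t \<longrightarrow> t = s" by (elim bexE)
  obtain a where a: "a \<in> \<Inter>T" using assms(3) by (meson all_not_in_conv)
  have "t \<subseteq> s" if "s \<in> T" for s
  proof -
    have "a \<in> s" "a \<in> t" using a by (auto intro: InterD that t(1))
    moreover have "s \<in> CC" "t \<in> CC" using subsetD[OF assms(1)] that t(1) by auto
    ultimately have "s \<subseteq> t \<or> t \<subseteq> s" by (intro laminar) auto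
    then show ?thesis using bspec[OF t(2) that] by auto
  qed
  then have "\<Inter>T = t" using t(1) by (intro antisym Inter_lower Inter_greatest)
  then show ?thesis using t(1) by simp
qed

lemma cjoin_props:
  assumes "v \<subseteq> R" "w \<subseteq> R" "v \<noteq> {}"
  shows cjoin_cluster: "cjoin v w \<in> CC" and cjoin_left: "v \<subseteq> cjoin v w" and cjoin_right: "w \<subseteq> cjoin v w"
proof -
  have "cjoin v w \<in> {t \<in> CC. v \<union> w \<subseteq> t}"
    unfolding cjoin_def
  proof (rule Inter_cluster)
    show "{t \<in> CC. v \<union> w \<subseteq> t} \<noteq> {}" using assms R_cluster by blast
    have "v \<subseteq> \<Inter>{t \<in> CC. v \<union> w \<subseteq> t}" by blast
    then show "\<Inter>{t \<in> CC. v \<union> w \<subseteq> t} \<noteq> {}" using assms(3) by blast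
  qed blast
  then show "cjoin v w \<in> CC" "v \<subseteq> cjoin v w" "w \<subseteq> cjoin v w" by auto
qed

lemma cjoin_least: "t \<in> CC \<Longrightarrow> v \<subseteq> t \<Longrightarrow> w \<subseteq> t \<Longrightarrow> cjoin v w \<subseteq> t"
  unfolding cjoin_def by blast

lemma cjoin_eqI:
  assumes "u \<in> CC" "v \<subseteq> u" "w \<subseteq> u" "\<And>t. t \<in> CC \<Longrightarrow> v \<subseteq> t \<Longrightarrow> w \<subseteq> t \<Longrightarrow> u \<subseteq> t"
  shows "cjoin v w = u"
proof
  show "cjoin v w \<subseteq> u" by (rule cjoin_least) (use assms in auto)
  show "u \<subseteq> cjoin v w" unfolding cjoin_def by (rule Inter_greatest) (use assms(4) in auto)
qed

lemma cjoin_commute: "cjoin v w = cjoin w v"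
  by (simp add: cjoin_def Un_commute)

lemma cjoin_absorb: "v \<in> CC \<Longrightarrow> w \<subseteq> v \<Longrightarrow> cjoin v w = v"
  by (rule cjoin_eqI) auto

lemma cjoin_pair:
  assumes "a \<in> R" "b \<in> R" "a \<noteq> b"
  shows "cjoin {a} {b} = {c \<in> R. ord (a - b) \<le> ord (c - a)}"
proof (rule cjoin_eqI)
  show "{c \<in> R. ord (a - b) \<le> ord (c - a)} \<in> CC"
    using ball_cluster[OF assms(1), of "rord (a - b)"] assms by (simp add: ord_eq)
  fix t assume t: "t \<in> CC" "{a} \<subseteq> t" "{b} \<subseteq> t"
  obtain r where r: "t = {b \<in> R. ereal r \<le> ord (b - a)}" using cluster_recenter[OF t(1)] t(2) by (metis insert_subset)
  then have "ereal r \<le> ord (a - b)" using t ord_minus_commute[of a b] by simp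
  then show "{c \<in> R. ord (a - b) \<le> ord (c - a)} \<subseteq> t" unfolding r using order_trans by blast
qed (use assms ord_minus_commute[of a b] in auto)

lemma cjoin_pair_mem:
  assumes "a \<in> R" "b \<in> R" "a \<noteq> b" "c \<in> cjoin {a} {b}" "c' \<in> cjoin {a} {b}"
  shows "ord (a - b) \<le> ord (c - c')"
proof -
  have "ord (a - b) \<le> ord (c - a)" "ord (a - b) \<le> ord (c' - a)" using assms by (auto simp: cjoin_pair)
  then show ?thesis using ord_diff_trans[of "ord (a - b)" c a c'] ord_minus_commute[of a c'] by simp
qed

text \<open>The minimum is attained at the pair itself, since all points of the join are at least as
  close as \<open>a\<close> and \<open>b\<close>. Depths thus become orders of differences of two
  roots.\<close>

lemma depth_cjoin_pair:
  assumes "a \<in> R" "b \<in> R" "a \<noteq> b"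
  shows "depth ord (cjoin {a} {b}) = ereal (rord (a - b))"
proof -
  have "depth ord (cjoin {a} {b}) = ord (a - b)"
    unfolding depth_def
  proof (rule Min_eqI)
    have "finite (cjoin {a} {b})" using cjoin_cluster[of "{a}" "{b}"] finite_cluster assms by simp
    then show "finite {ord (r - r') |r r'. r \<in> cjoin {a} {b} \<and> r' \<in> cjoin {a} {b}}"
      by (intro finite_image_set2) simp_all
    show "ord (a - b) \<in> {ord (r - r') |r r'. r \<in> cjoin {a} {b} \<and> r' \<in> cjoin {a} {b}}"
      using cjoin_left[of "{a}" "{b}"] cjoin_right[of "{a}" "{b}"] assms by auto
  qed (use cjoin_pair_mem assms in auto)
  then show ?thesis using assms by (simp add: ord_eq)
qed

lemma proper_iff: "s \<in> CC \<Longrightarrow> proper s \<longleftrightarrow> (\<exists>a\<in>s. \<exists>b\<in>s. a \<noteq> b)"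
  using finite_cluster[of s] card_le_Suc0_iff_eq[of s] by (auto simp: not_le[symmetric])

text \<open>Take a maximal join of two distinct points of \<open>s\<close>. For any further
  \<open>c\<close>, the join of \<open>a\<close> and \<open>c\<close> shares \<open>a\<close> with
  it, so it is comparable and by maximality contained in it; hence the maximal join is all of
  \<open>s\<close>.\<close>

lemma proper_cluster_pair:
  assumes "s \<in> CC" "proper s"
  obtains a b where "a \<in> R" "b \<in> R" "a \<noteq> b" "s = cjoin {a} {b}"
proof -
  define T where "T = {cjoin {a} {b} |a b. a \<in> s \<and> b \<in> s \<and> a \<noteq> b}"
  have sR: "s \<subseteq> R" using assms cluster_subset by blast
  have "T \<subseteq> (\<lambda>(a, b). cjoin {a} {b}) ` (s \<times> s)" unfolding T_def by auto
  then have "finite T" by (rule finite_subset) (use finite_cluster assms in simp)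
  moreover have "T \<noteq> {}" using assms proper_iff unfolding T_def by blast
  ultimately obtain t where t: "t \<in> T" "\<forall>s\<in>T. t \<subseteq> s \<longrightarrow> t = s"
    using finite_has_maximal[of T] by blast
  then obtain a b where ab: "a \<in> s" "b \<in> s" "a \<noteq> b" "t = cjoin {a} {b}" unfolding T_def by blast
  have tC: "t \<in> CC" "a \<in> t" "b \<in> t" using cjoin_props[of "{a}" "{b}"] ab sR by auto
  have "t \<subseteq> s" using cjoin_least ab assms by auto
  moreover have "c \<in> t" if c: "c \<in> s" for c
  proof (cases "c = a")
    case False
    have cjoin': "cjoin {a} {c} \<in> CC" "a \<in> cjoin {a} {c}" "c \<in> cjoin {a} {c}" using cjoin_props[of "{a}" "{c}"] ab sR c by auto
    have "cjoin {a} {c} \<in> T" unfolding T_def using ab c False by blast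
    moreover have "cjoin {a} {c} \<subseteq> t \<or> t \<subseteq> cjoin {a} {c}" using laminar cjoin' tC by blast
    ultimately show ?thesis using t(2) cjoin' by blast
  qed (use tC in simp)
  ultimately have "s = t" by blast
  then show thesis using that ab sR by blast
qed

text \<open>Meaningful for proper clusters only: a singleton has infinite depth, which is sent to
  \<open>0\<close>.\<close>

definition rdepth :: "'a set \<Rightarrow> real" where
  "rdepth s = real_of_ereal (depth ord s)"

lemma rdepth_cjoin_pair: "a \<in> R \<Longrightarrow> b \<in> R \<Longrightarrow> a \<noteq> b \<Longrightarrow> rdepth (cjoin {a} {b}) = rord (a - b)"
  by (simp add: rdepth_def depth_cjoin_pair)

lemma depth_proper: "s \<in> CC \<Longrightarrow> proper s \<Longrightarrow> depth ord s = ereal (rdepth s)"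
  by (erule proper_cluster_pair) (simp_all add: rdepth_cjoin_pair depth_cjoin_pair)

text \<open>If the depth did not drop, every point of \<open>t\<close> would be as close to
  \<open>a\<close> as \<open>b\<close> is, and so would belong to \<open>s\<close>.\<close>

lemma rdepth_strict:
  assumes "s \<in> CC" "t \<in> CC" "proper s" "s \<subset> t"
  shows "rdepth t < rdepth s"
proof -
  obtain a b where ab: "a \<in> R" "b \<in> R" "a \<noteq> b" "s = cjoin {a} {b}"
    using proper_cluster_pair assms by blast
  have "card s < card t" using psubset_card_mono[of t s] finite_cluster assms by blast
  then have "proper t" using assms(3) by simp
  then obtain c e where ce: "c \<in> R" "e \<in> R" "c \<noteq> e" "t = cjoin {c} {e}"
    using proper_cluster_pair assms by blast
  have mem: "a \<in> t" "b \<in> t" using assms(4) ab cjoin_left[of "{a}" "{b}"] cjoin_right[of "{a}" "{b}"] by auto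
  have "\<not> ord (a - b) \<le> ord (c - e)"
  proof
    assume *: "ord (a - b) \<le> ord (c - e)"
    have "t \<subseteq> s"
    proof
      fix z assume z: "z \<in> t"
      then have "ord (c - e) \<le> ord (z - a)" using cjoin_pair_mem[of c e z a] ce mem by simp
      then have "ord (a - b) \<le> ord (z - a)" using * by (rule order_trans[rotated])
      then show "z \<in> s" using ab z assms(2) cluster_subset by (auto simp: cjoin_pair)
    qed
    then show False using assms(4) by blast
  qed
  then show ?thesis using ab ce by (simp add: rdepth_cjoin_pair ord_eq)
qed

abbreviation "par \<equiv> parent ord R"

text \<open>The clusters strictly containing \<open>s\<close> share its points and include
  \<open>R\<close>, so \<open>Inter_cluster\<close> provides a least one and the
  \<open>LEAST\<close> in \<open>parent\<close> is attained.\<close>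

lemma parent_props:
  assumes "s \<in> CC" "s \<noteq> R"
  shows parent_cluster: "par s \<in> CC" and parent_psubset: "s \<subset> par s"
    and parent_least: "\<And>t. t \<in> CC \<Longrightarrow> s \<subset> t \<Longrightarrow> par s \<subseteq> t"
proof -
  let ?T = "{t \<in> CC. s \<subset> t}"
  have I: "\<Inter>?T \<in> ?T"
  proof (rule Inter_cluster)
    show "?T \<noteq> {}" using assms R_cluster cluster_subset by blast
    show "\<Inter>?T \<noteq> {}" using cluster_nonempty[OF assms(1)] by blast
  qed blast
  have "par s = \<Inter>?T" unfolding parent_def by (rule Least_equality) (use I in auto)
  then show "par s \<in> CC" "s \<subset> par s" "\<And>t. t \<in> CC \<Longrightarrow> s \<subset> t \<Longrightarrow> par s \<subseteq> t"
    using I by auto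
qed

subsection \<open>Paths in the tree\<close>

abbreviation "V \<equiv> tree_verts ord R"
abbreviation "E \<equiv> tree_edges ord R"

lemma V_cluster: "t \<in> V \<Longrightarrow> t \<in> CC"
  by (auto simp: tree_verts_def split: if_splits)

lemma V_I: "t \<in> CC \<Longrightarrow> t \<noteq> R \<Longrightarrow> t \<in> V"
  by (auto simp: tree_verts_def)

lemma finite_V: "finite V"
  by (rule finite_subset[OF _ finite_clusters]) (use V_cluster in blast)

lemma top_splitD:
  assumes "top_split ord R s t"
  shows "s \<in> CC" "s \<noteq> R" "par s = R" "t \<in> CC" "t \<noteq> R" "par t = R"
    "s \<inter> t = {}" "s \<union> t = R" "R \<notin> V"
proof -
  show "R \<notin> V" unfolding tree_verts_def using assms by (metis Diff_iff singletonI)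
qed (use assms in \<open>simp_all add: top_split_def top_children_def\<close>)

lemma top_split_commute: "top_split ord R s t \<longleftrightarrow> top_split ord R t s"
  by (auto simp: top_split_def)

lemma R_notin_V_obtain:
  assumes "R \<notin> V" obtains s t where "top_split ord R s t"
  using assms R_cluster by (auto simp: tree_verts_def split: if_splits)

text \<open>Edges oriented upwards. The condition on \<open>t\<close> leaves out the edges to a
  removed root, whose two children are joined by \<open>top_split\<close> instead.\<close>

definition child_edge :: "'a set \<Rightarrow> 'a set \<Rightarrow> bool" where
  "child_edge s t \<longleftrightarrow> s \<in> CC \<and> s \<noteq> R \<and> par s = t \<and> t \<in> V"

lemma edge_iff: "{a, b} \<in> E \<longleftrightarrow> child_edge a b \<or> child_edge b a \<or> top_split ord R a b"
  unfolding tree_edges_def child_edge_def using top_split_commute by (auto simp: doubleton_eq_iff)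

lemma child_edgeD:
  assumes "child_edge s t"
  shows "s \<in> CC" "s \<noteq> R" "par s = t" "t \<in> V" "t \<in> CC" "s \<in> V" "s \<subset> t" "\<not> t \<subseteq> s"
  using assms parent_psubset[of s] V_cluster V_I unfolding child_edge_def by auto

lemma child_edge_least: "child_edge s t \<Longrightarrow> z \<in> CC \<Longrightarrow> s \<subset> z \<Longrightarrow> t \<subseteq> z"
  using parent_least[of s z] unfolding child_edge_def by blast

text \<open>No cluster lies strictly between \<open>s\<close> and its parent, so by
  \<open>laminar\<close> a cluster meeting \<open>s\<close> either stays inside \<open>s\<close> or
  reaches the parent.\<close>

lemma child_cases:
  assumes "s \<in> CC" "s \<noteq> R" "z \<in> CC" "z \<inter> s \<noteq> {}"
  shows "z \<subseteq> s \<or> par s \<subseteq> z"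
  using laminar[OF assms(3,1,4)] parent_least[OF assms(1,2,3)] by blast

lemma V_R: "t \<in> V \<Longrightarrow> R \<subseteq> t \<Longrightarrow> t = R"
  using V_cluster cluster_subset by blast

text \<open>\<open>u\<close> is the neighbour of \<open>v\<close> in the direction of \<open>w\<close>.\<close>

definition next_step :: "'a set \<Rightarrow> 'a set \<Rightarrow> 'a set \<Rightarrow> bool" where
  "next_step v u w \<longleftrightarrow>
     (child_edge v u \<and> \<not> w \<subseteq> v) \<or> (child_edge u v \<and> w \<subseteq> u) \<or> (top_split ord R v u \<and> w \<subseteq> u)"

lemma next_step_V: "next_step v u w \<Longrightarrow> v \<in> V \<and> u \<in> V"
  unfolding next_step_def using child_edgeD(4,6) V_I top_splitD(1,2,4,5) by blast

lemma next_step_edge: "next_step v u w \<Longrightarrow> {v, u} \<in> E"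
  unfolding next_step_def edge_iff by blast

lemma next_step_start: "{v, u} \<in> E \<Longrightarrow> next_step v u u"
  unfolding next_step_def edge_iff by (auto dest: child_edgeD)

text \<open>The vertices \<open>a\<close> with \<open>next_step v u a\<close> form the far side of
  the edge from \<open>v\<close> to \<open>u\<close>: the vertices not inside \<open>v\<close> for
  an upward edge, those inside \<open>u\<close> otherwise. An edge can leave this side only by
  entering \<open>v\<close>, which shows that the graph has no cycles.\<close>

lemma next_step_invariant:
  assumes "next_step v u a" "{a, b} \<in> E" "b \<noteq> v"
  shows "next_step v u b"
proof -
  have top_sub: False if "top_split ord R a c" "a \<subset> s" "s \<in> CC" "s \<noteq> R" for c s
    using parent_least[of a s] top_splitD[OF that(1)] that cluster_subset by blast
  from assms(1) consider "child_edge v u" "\<not> a \<subseteq> v" | "child_edge u v" "a \<subseteq> u"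
    | "top_split ord R v u" "a \<subseteq> u"
    unfolding next_step_def by blast
  then show ?thesis
  proof cases
    case 1
    have "\<not> b \<subseteq> v"
    proof
      assume "b \<subseteq> v"
      then have bv: "b \<subset> v" using assms(3) by blast
      from assms(2) show False
        unfolding edge_iff
      proof (elim disjE)
        assume "child_edge a b" then show False using child_edgeD(7) bv 1 by blast
      next
        assume "child_edge b a" then show False using child_edge_least child_edgeD(1)[OF 1(1)] bv 1 by blast
      next
        assume s: "top_split ord R a b"
        then have "R \<subseteq> v" using parent_least[of b v] top_splitD[OF s] child_edgeD(1)[OF 1(1)] bv by simp
        then show False using child_edgeD(1,2)[OF 1(1)] cluster_subset by blast
      qed
    qed
    then show ?thesis using 1 unfolding next_step_def by blast
  next
    case 2
    note u = child_edgeD[OF 2(1)]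
    from assms(2) have "b \<subseteq> u"
      unfolding edge_iff
    proof (elim disjE)
      assume ab: "child_edge a b"
      show ?thesis
      proof (cases "a = u")
        case True then show ?thesis using ab u assms(3) child_edgeD(3)[OF ab] by simp
      next
        case False then show ?thesis using child_edge_least[OF ab u(1)] 2 by blast
      qed
    next
      assume "child_edge b a" then show ?thesis using child_edgeD(7) 2 by blast
    next
      assume s: "top_split ord R a b"
      have "a \<noteq> u" using top_splitD[OF s] u by auto
      then show ?thesis using top_sub[OF s _ u(1,2)] 2 by blast
    qed
    then show ?thesis using 2 unfolding next_step_def by blast
  next
    case 3
    note u = top_splitD[OF 3(1)]
    from assms(2) have "b \<subseteq> u"
      unfolding edge_iff
    proof (elim disjE)
      assume ab: "child_edge a b"
      then have "a \<noteq> u" using u child_edgeD[OF ab] by auto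
      then show ?thesis using child_edge_least[OF ab u(4)] 3 by blast
    next
      assume "child_edge b a" then show ?thesis using child_edgeD(7) 3 by blast
    next
      assume s: "top_split ord R a b"
      show ?thesis
      proof (cases "a = u")
        case True
        then have "b = v" using u(7,8) top_splitD(7,8)[OF s] by auto
        then show ?thesis using assms(3) by simp
      next
        case False then show ?thesis using top_sub[OF s _ u(4,5)] 3 by blast
      qed
    qed
    then show ?thesis using 3 unfolding next_step_def by blast
  qed
qed

text \<open>A walk that begins on the far side and avoids \<open>v\<close> stays there, so its last
  vertex determines the direction in which it left \<open>v\<close>.\<close>

lemma next_step_last:
  assumes "next_step v u a" "successively (\<lambda>a b. {a, b} \<in> E) (a # p)" "v \<notin> set p"
  shows "next_step v u (last (a # p))"
  using assms
proof (induction p arbitrary: a)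
  case (Cons b p)
  then have "next_step v u b" using next_step_invariant[of v u a b] by auto
  then show ?case using Cons by simp
qed simp

text \<open>The three kinds of step exclude each other. Within one kind the target is forced: the
  parent is unique, two children of \<open>v\<close> containing the nonempty \<open>w\<close> meet
  and hence coincide, and the other half of a top split is the complement of
  \<open>v\<close>.\<close>

lemma next_step_unique:
  assumes "next_step v u w" "next_step v u' w" "w \<in> CC"
  shows "u = u'"
proof -
  have w: "w \<noteq> {}" using assms cluster_nonempty by blast
  have children: "s = t" if "child_edge s v" "child_edge t v" "w \<subseteq> s" "w \<subseteq> t" for s t
  proof -
    note s = child_edgeD[OF that(1)] and t = child_edgeD[OF that(2)]
    have "s \<inter> t \<noteq> {}" using that w by blast
    then show ?thesis using laminar[OF s(1) t(1)] s(8) t(8) child_edge_least[OF that(1) t(1)] child_edge_least[OF that(2) s(1)] by blast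
  qed
  have no_mix: False if "child_edge v s" "top_split ord R v t" for s t
    using child_edgeD[OF that(1)] top_splitD[OF that(2)] by auto
  have no_mix': False if "child_edge s v" "w \<subseteq> s" "top_split ord R v t" "w \<subseteq> t" for s t
    using child_edgeD(7)[OF that(1)] top_splitD(7)[OF that(3)] that w by blast
  have sp: "s = t" if "top_split ord R v s" "top_split ord R v t" for s t
    using top_splitD(7,8)[OF that(1)] top_splitD(7,8)[OF that(2)] by auto
  have par_child: False if "child_edge s v" "w \<subseteq> s" "\<not> w \<subseteq> v" for s
    using child_edgeD(7)[OF that(1)] that by blast
  have pars: "s = t" if "child_edge v s" "child_edge v t" for s t
    using child_edgeD(3) that by metis
  have three: "(child_edge v z \<and> \<not> w \<subseteq> v) \<or> (child_edge z v \<and> w \<subseteq> z) \<or> (top_split ord R v z \<and> w \<subseteq> z)"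
    if "next_step v z w" for z
    using that unfolding next_step_def .
  from three[OF assms(1)] show ?thesis
  proof (elim disjE conjE)
    assume 1: "child_edge v u" "\<not> w \<subseteq> v"
    from three[OF assms(2)] show ?thesis
      by (elim disjE conjE) (use 1 pars[of u u'] par_child[of u'] no_mix[of u u'] in simp_all)
  next
    assume 1: "child_edge u v" "w \<subseteq> u"
    from three[OF assms(2)] show ?thesis
      by (elim disjE conjE) (use 1 par_child[of u] children[of u u'] no_mix'[of u u'] in simp_all)
  next
    assume 1: "top_split ord R v u" "w \<subseteq> u"
    from three[OF assms(2)] show ?thesis
      by (elim disjE conjE) (use 1 no_mix[of u' u] no_mix'[of u' u] sp[of u u'] in simp_all)
  qed
qed

text \<open>If \<open>w\<close> lies below \<open>v\<close>, the maximal cluster strictly below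
  \<open>v\<close> that contains \<open>w\<close> is a child of \<open>v\<close>. Otherwise the step
  goes to the parent, or across to the other child if the parent is the removed root.\<close>

lemma next_step_exists:
  assumes "v \<in> V" "w \<in> V" "v \<noteq> w"
  obtains u where "next_step v u w"
proof (cases "w \<subseteq> v")
  case True
  let ?T = "{t \<in> CC. w \<subseteq> t \<and> t \<subset> v}"
  have "finite ?T" using finite_clusters by simp
  moreover have "w \<in> ?T" using True assms V_cluster by blast
  ultimately obtain t where t: "t \<in> ?T" "\<forall>s\<in>?T. t \<le> s \<longrightarrow> t = s"
    using finite_has_maximal[of ?T] by blast
  then have tC: "t \<in> CC" "w \<subseteq> t" "t \<subset> v" by auto
  then have tR: "t \<noteq> R" using assms(1) V_cluster cluster_subset by blast
  have "par t \<subseteq> v" using parent_least[OF tC(1) tR] tC assms V_cluster by blast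
  moreover have "\<not> par t \<subset> v"
    using t(2) parent_cluster[OF tC(1) tR] parent_psubset[OF tC(1) tR] tC by blast
  ultimately have "child_edge t v" using tC tR assms unfolding child_edge_def by auto
  then show thesis using that tC unfolding next_step_def by blast
next
  case False
  have vC: "v \<in> CC" "w \<in> CC" using assms V_cluster by auto
  have vR: "v \<noteq> R" using False vC cluster_subset by blast
  show thesis
  proof (cases "par v \<in> V")
    case True
    then show thesis using that[of "par v"] vC vR False unfolding next_step_def child_edge_def by blast
  next
    assume n: "par v \<notin> V"
    \<comment> \<open>Only the root can be missing from \<open>V\<close>, so \<open>v\<close> is one
      of the two children joined across it.\<close>
    then have pR: "par v = R" using V_I parent_cluster[OF vC(1) vR] by blast
    obtain s0 t0 where st0: "top_split ord R s0 t0" using n pR R_notin_V_obtain by metis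
    obtain a where a: "a \<in> v" "a \<in> R" using cluster_nonempty vC cluster_subset by blast
    obtain s t where st: "top_split ord R s t" "a \<in> s"
      using st0 a top_splitD(8)[OF st0] top_split_commute by blast
    note st' = top_splitD[OF st(1)]
    have sub: "z = s" if "z \<in> CC" "z \<noteq> R" "a \<in> z" "par z = R" for z
    proof -
      have "z \<inter> s \<noteq> {}" "s \<inter> z \<noteq> {}" using st(2) that(3) by auto
      then have "z \<subseteq> s \<or> R \<subseteq> z" "s \<subseteq> z \<or> R \<subseteq> s"
        using child_cases[of s z] child_cases[of z s] st'(1-3) that by auto
      moreover have "z \<subseteq> R" "s \<subseteq> R" using that(1) st'(1) cluster_subset by auto
      ultimately show ?thesis using that(2) st'(2) by auto
    qed
    have vs: "v = s" by (rule sub) (use vC vR a pR in auto)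
    have wR: "w \<noteq> R" using assms(2) st'(9) by auto
    have wsub: "w \<subseteq> R" using vC(2) cluster_subset by auto
    have "w \<subseteq> t"
    proof (cases "w \<inter> s = {}")
      case True then show ?thesis using st'(8) wsub by auto
    next
      case f: False
      then have "w \<subseteq> s \<or> R \<subseteq> w" using child_cases[of s w] st'(1-3) vC by simp
      then show ?thesis using wR wsub False vs by auto
    qed
    then show thesis using that[of t] st vs unfolding next_step_def by blast
  qed
qed

section \<open>Vertex sets of paths\<close>

text \<open>The vertices on the path from \<open>v\<close> to \<open>w\<close>. The join of \<open>v\<close> and \<open>w\<close> is not a vertex if it is the removed root.\<close>

definition path_verts :: "'a set \<Rightarrow> 'a set \<Rightarrow> 'a set set" where
  "path_verts v w = {t \<in> V. (v \<subseteq> t) \<noteq> (w \<subseteq> t)} \<union> ({cjoin v w} \<inter> V)"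

lemma path_verts_self: "v \<in> V \<Longrightarrow> path_verts v v = {v}"
  using cjoin_absorb[of v v] V_cluster by (auto simp: path_verts_def)

lemma path_verts_commute: "path_verts v w = path_verts w v"
  by (auto simp: path_verts_def cjoin_commute)

text \<open>The clusters containing \<open>v\<close> are \<open>v\<close> itself and those
  containing \<open>u\<close>, so moving up loses only \<open>v\<close>.\<close>

lemma next_step_parent:
  assumes "child_edge v u" "\<not> w \<subseteq> v" "w \<in> V"
  shows "cjoin v w = cjoin u w" "path_verts v w = insert v (path_verts u w)" "v \<notin> path_verts u w"
proof -
  note e = child_edgeD[OF assms(1)]
  have sub: "v \<subseteq> t \<longleftrightarrow> t = v \<or> u \<subseteq> t" if "t \<in> CC" for t
    using e(7) child_edge_least[OF assms(1) that] by blast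
  have R: "u \<subseteq> R" "w \<subseteq> R" "u \<noteq> {}"
    using e assms(3) V_cluster cluster_subset cluster_nonempty by auto
  show cjoin: "cjoin v w = cjoin u w"
  proof (rule cjoin_eqI)
    show "cjoin u w \<in> CC" "w \<subseteq> cjoin u w" using cjoin_props[OF R] by auto
    show "v \<subseteq> cjoin u w" using cjoin_left[OF R] e(7) by blast
    show "cjoin u w \<subseteq> t" if "t \<in> CC" "v \<subseteq> t" "w \<subseteq> t" for t
      using cjoin_least[of t u w] sub that assms(2) by blast
  qed
  show "v \<notin> path_verts u w"
    using e(8) assms(2) cjoin_right[OF R] unfolding path_verts_def by blast
  show "path_verts v w = insert v (path_verts u w)"
    unfolding path_verts_def cjoin using sub[OF V_cluster] e(6) assms(2) by blast
qed

text \<open>A cluster containing \<open>w\<close> lies inside \<open>u\<close> or contains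
  \<open>v\<close>, so moving down loses only \<open>v\<close>.\<close>

lemma next_step_child:
  assumes "child_edge u v" "w \<subseteq> u" "w \<in> V"
  shows "cjoin v w = v" "cjoin u w = u" "path_verts v w = insert v (path_verts u w)" "v \<notin> path_verts u w"
proof -
  note e = child_edgeD[OF assms(1)]
  have wv: "w \<subseteq> v" using assms(2) e(7) by blast
  have "w \<noteq> {}" using assms(3) V_cluster cluster_nonempty by blast
  show cjoin: "cjoin v w = v" "cjoin u w = u" using cjoin_absorb e assms(2) wv by auto
  have sub: "t \<subseteq> u \<or> v \<subseteq> t" if "t \<in> CC" "w \<subseteq> t" for t
    using child_cases[OF e(1,2) that(1)] e(3) that assms(2) \<open>w \<noteq> {}\<close> by blast
  show "v \<notin> path_verts u w" unfolding path_verts_def cjoin using e(7) wv by blast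
  have "t \<in> path_verts v w \<longleftrightarrow> t \<in> insert v (path_verts u w)" for t
    unfolding path_verts_def cjoin using sub[of t] e(4,6,7) assms(2) V_cluster[of t] wv by blast
  then show "path_verts v w = insert v (path_verts u w)" by blast
qed

text \<open>Here the join of \<open>v\<close> and \<open>w\<close> is the removed root and
  contributes no vertex. The only vertex containing \<open>v\<close> is \<open>v\<close> itself, and
  all vertices containing \<open>w\<close> lie in \<open>u\<close>.\<close>

lemma next_step_split:
  assumes "top_split ord R v u" "w \<subseteq> u" "w \<in> V"
  shows "cjoin v w = R" "cjoin u w = u" "path_verts v w = insert v (path_verts u w)" "v \<notin> path_verts u w"
proof -
  note e = top_splitD[OF assms(1)]
  have w: "w \<noteq> {}" using assms(3) V_cluster cluster_nonempty by blast
  have v: "v \<noteq> {}" using e(1) cluster_nonempty by blast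
  have vV: "v \<in> V" "u \<in> V" using e V_I by auto
  have wv: "\<not> w \<subseteq> v" using w assms(2) e(7) by blast
  show cjoin: "cjoin u w = u" using cjoin_absorb e assms(2) by auto
  show cjoin': "cjoin v w = R"
  proof (rule cjoin_eqI)
    show "R \<subseteq> t" if "t \<in> CC" "v \<subseteq> t" "w \<subseteq> t" for t
      using parent_least[OF e(1,2) that(1)] e(3) that wv by blast
  qed (use R_cluster e assms(2) in auto)
  have sub: "t \<subseteq> u" if "t \<in> V" "w \<subseteq> t" for t
  proof -
    have "t \<inter> u \<noteq> {}" using that(2) assms(2) w by auto
    then have "t \<subseteq> u \<or> R \<subseteq> t" using child_cases[OF e(4,5), of t] e(6) V_cluster[OF that(1)] by simp
    then show ?thesis using V_R[OF that(1)] that(1) e(9) by auto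
  qed
  have sub': "t = v" if "t \<in> V" "v \<subseteq> t" for t
    using parent_least[OF e(1,2) V_cluster[OF that(1)]] V_R[OF that(1)] e(3,9) that by auto
  have uv: "\<not> u \<subseteq> v" "\<not> v \<subseteq> u" "v \<noteq> u" using wv assms(2) v e(7) by auto
  then show "v \<notin> path_verts u w" unfolding path_verts_def cjoin using wv by simp
  have "t \<in> path_verts v w \<longleftrightarrow> t \<in> insert v (path_verts u w)" for t
  proof (cases "t = v \<or> t = u")
    case True then show ?thesis using vV uv wv assms(2) by (auto simp: path_verts_def cjoin)
  next
    case False
    then have "t \<in> path_verts v w \<longleftrightarrow> t \<in> V \<and> w \<subseteq> t" using sub' e(9) by (auto simp: path_verts_def cjoin')
    moreover have "t \<in> path_verts u w \<longleftrightarrow> t \<in> V \<and> w \<subseteq> t" using sub[of t] False assms(2) by (auto simp: path_verts_def cjoin)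
    ultimately show ?thesis using False by simp
  qed
  then show "path_verts v w = insert v (path_verts u w)" by blast
qed

lemma path_verts_step:
  assumes "next_step v u w" "w \<in> V"
  shows "path_verts v w = insert v (path_verts u w)" "v \<notin> path_verts u w"
  using assms next_step_parent next_step_child next_step_split unfolding next_step_def by metis+

section \<open>Existence and uniqueness of paths\<close>

lemma is_path_Cons:
  assumes "is_path E v (v # u # q) w"
  shows "next_step v u w" "is_path E u (u # q) w"
proof -
  have p: "{v, u} \<in> E" "successively (\<lambda>a b. {a, b} \<in> E) (u # q)" "v \<notin> set (u # q)" "last (u # q) = w"
    using assms by (auto simp: is_path_def)
  show "next_step v u w" using next_step_last[OF next_step_start[OF p(1)] p(2)] p by simp
  show "is_path E u (u # q) w" using assms by (auto simp: is_path_def)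
qed

lemma is_path_cases:
  assumes "is_path E v p w"
  obtains "p = [v]" "v = w" | u q where "p = v # u # q" "next_step v u w" "is_path E u (u # q) w" "v \<noteq> w"
proof (cases p)
  case (Cons a p')
  then have a: "p = v # p'" using assms by (auto simp: is_path_def)
  show thesis
  proof (cases p')
    case Nil then show thesis using that(1) a assms by (auto simp: is_path_def)
  next
    case (Cons u q)
    then have "v \<noteq> w" using a assms by (auto simp: is_path_def split: if_splits)
    then show thesis using that(2)[of u q] is_path_Cons[of v u q w] assms a Cons by simp
  qed
qed (use assms in \<open>auto simp: is_path_def\<close>)

text \<open>The first step of any path is a \<open>next_step\<close> towards its end, which is
  unique; induction does the rest.\<close>

lemma is_path_unique:
  assumes "is_path E v p w" "is_path E v q w" "w \<in> CC"
  shows "p = q"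
  using assms
proof (induction p arbitrary: v q)
  case (Cons a p)
  from Cons.prems(1) show ?case
  proof (cases rule: is_path_cases)
    case 1
    from Cons.prems(2) show ?thesis
      by (cases rule: is_path_cases) (use 1 in auto)
  next
    case (2 u p')
    from Cons.prems(2) show ?thesis
    proof (cases rule: is_path_cases)
      case 1 then show ?thesis using 2 by simp
    next
      case (2 u' q')
      note 22 = \<open>next_step v u w\<close> \<open>is_path E u (u # p') w\<close> \<open>a # p = v # u # p'\<close>
      have "u = u'" using next_step_unique 22(1) 2(2) Cons.prems(3) by blast
      then show ?thesis using Cons.IH[of u "u' # q'"] 22 2 Cons.prems(3) by simp
    qed
  qed
qed (simp add: is_path_def)

lemma finite_path_verts: "finite (path_verts v w)"
  by (rule finite_subset[OF _ finite_V]) (auto simp: path_verts_def)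

text \<open>Induction along the path towards the fixed end \<open>w\<close>. It is well-founded
  because each step removes \<open>v\<close> from the finite set
  \<open>path_verts v w\<close>.\<close>

lemma path_induct [consumes 2, case_names refl step]:
  assumes "v \<in> V" "w \<in> V" "Q w"
    "\<And>v u. v \<in> V \<Longrightarrow> u \<in> V \<Longrightarrow> v \<noteq> w \<Longrightarrow> next_step v u w \<Longrightarrow> Q u \<Longrightarrow> Q v"
  shows "Q v"
  using assms(1)
proof (induction "card (path_verts v w)" arbitrary: v rule: less_induct)
  case less
  show ?case
  proof (cases "v = w")
    case False
    then obtain u where u: "next_step v u w" using next_step_exists less assms(2) by blast
    then have uV: "u \<in> V" using next_step_V by blast
    have "card (path_verts u w) < card (path_verts v w)"
      using path_verts_step[OF u assms(2)] finite_path_verts by simp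
    then show ?thesis using less uV assms(4) u False by blast
  qed (use assms(3) in simp)
qed

lemma tree_path_eqI: "is_path E v p w \<Longrightarrow> w \<in> V \<Longrightarrow> tree_path ord R v w = p"
  unfolding tree_path_def using is_path_unique V_cluster by blast

text \<open>Following \<open>next_step\<close> builds a path whose vertices are those of
  \<open>path_verts\<close>; by uniqueness it is the one selected in
  \<open>tree_path\<close>.\<close>

lemma tree_path_props:
  assumes "v \<in> V" "w \<in> V"
  shows "is_path E v (tree_path ord R v w) w \<and> set (tree_path ord R v w) = path_verts v w"
proof -
  have "\<exists>p. is_path E v p w \<and> set p = path_verts v w"
    using assms
  proof (induction v rule: path_induct)
    case refl
    then show ?case using path_verts_self assms by (intro exI[of _ "[w]"]) (auto simp: is_path_def)
  next
    case (step v u)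
    then obtain p where p: "is_path E u p w" "set p = path_verts u w" by blast
    then obtain q where q: "p = u # q" by (cases p) (auto simp: is_path_def)
    have "is_path E v (v # p) w"
      using p path_verts_step[OF step(4) assms(2)] next_step_edge[OF step(4)] q by (auto simp: is_path_def)
    then show ?case using p path_verts_step[OF step(4) assms(2)] by (intro exI[of _ "v # p"]) auto
  qed
  then show ?thesis using tree_path_eqI assms by metis
qed

lemma set_tree_path: "v \<in> V \<Longrightarrow> w \<in> V \<Longrightarrow> set (tree_path ord R v w) = path_verts v w"
  using tree_path_props by blast

lemma length_tree_path: "v \<in> V \<Longrightarrow> w \<in> V \<Longrightarrow> length (tree_path ord R v w) = card (path_verts v w)"
  using tree_path_props[of v w] distinct_card[of "tree_path ord R v w"] by (simp add: is_path_def)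

lemma tree_path_self: "v \<in> V \<Longrightarrow> tree_path ord R v v = [v]"
  by (rule tree_path_eqI) (auto simp: is_path_def)

lemma path_verts_ends: "v \<in> V \<Longrightarrow> w \<in> V \<Longrightarrow> v \<in> path_verts v w \<and> w \<in> path_verts v w"
  using tree_path_props[of v w] unfolding is_path_def by (metis hd_in_set last_in_set)

lemma tree_path_Cons:
  assumes "next_step v u w" "w \<in> V"
  shows "\<exists>q. tree_path ord R u w = u # q \<and> tree_path ord R v w = v # u # q"
proof -
  have V: "v \<in> V" "u \<in> V" using assms next_step_V by auto
  have p: "is_path E u (tree_path ord R u w) w" "set (tree_path ord R u w) = path_verts u w"
    using tree_path_props V assms by auto
  then obtain q where q: "tree_path ord R u w = u # q"
    by (cases "tree_path ord R u w") (auto simp: is_path_def)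
  have "is_path E v (v # u # q) w"
    using p path_verts_step[OF assms] next_step_edge[OF assms(1)] q by (auto simp: is_path_def)
  then show ?thesis using tree_path_eqI assms q by blast
qed

section \<open>Distances in terms of depths\<close>

lemma tree_dist_step:
  assumes "next_step v u w" "w \<in> V"
  shows "tree_dist ord R v w = edge_length ord R v u + tree_dist ord R u w"
  using tree_path_Cons[OF assms] by (auto simp: tree_dist_def Let_def)

lemma proper_mono: "proper s \<Longrightarrow> s \<subseteq> t \<Longrightarrow> t \<in> CC \<Longrightarrow> proper t"
  using card_mono[of t s] finite_cluster by fastforce

lemma path_verts_superset:
  assumes "t \<in> path_verts v w" "v \<in> V" "w \<in> V" shows "v \<subseteq> t \<or> w \<subseteq> t"
  using assms cjoin_left[of v w] V_cluster cluster_subset cluster_nonempty unfolding path_verts_def by blast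

lemma rel_depth_eq:
  assumes "s \<in> CC" "s \<noteq> R" "proper s"
  shows "rel_depth ord R s = rdepth s - rdepth (par s)"
proof -
  have "proper (par s)" using proper_mono assms parent_psubset parent_cluster by blast
  then show ?thesis
    unfolding rel_depth_def using depth_proper assms parent_cluster by simp
qed

text \<open>The distance formula of a rooted tree: up to the join and down again. It survives
  removal of the root, because the edge across it has the summed length of the two edges that it
  replaces and \<open>rdepth\<close> still makes sense for \<open>R\<close>.\<close>

lemma tree_dist_eq:
  assumes "v \<in> V" "w \<in> V" "proper v" "proper w"
  shows "tree_dist ord R v w = rdepth v + rdepth w - 2 * rdepth (cjoin v w)"
  using assms(1,2,3)
proof (induction v rule: path_induct)
  case refl
  show ?case using tree_path_self[OF assms(2)] cjoin_absorb[of w w] V_cluster assms(2)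
    by (simp add: tree_dist_def)
next
  case (step v u)
  have VC: "v \<in> CC" "u \<in> CC" using step V_cluster by auto
  have "u \<in> path_verts v w" using path_verts_step[OF step(4) assms(2)] path_verts_ends step assms(2) by blast
  then have "v \<subseteq> u \<or> w \<subseteq> u" using path_verts_superset step(1) assms(2) by simp
  \<comment> \<open>Vertices of the path contain \<open>v\<close> or \<open>w\<close>, so they are
    proper and no edge length is \<open>undefined\<close>.\<close>
  then have pu: "proper u"
    using proper_mono[OF step.prems _ VC(2)] proper_mono[OF assms(4) _ VC(2)] by auto
  have el: "edge_length ord R v u = (if v \<noteq> R \<and> u = par v then rel_depth ord R v
      else if u \<noteq> R \<and> v = par u then rel_depth ord R u
      else rel_depth ord R v + rel_depth ord R u)"
    using pu step.prems by (simp add: edge_length_def)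
  have IH: "tree_dist ord R u w = rdepth u + rdepth w - 2 * rdepth (cjoin u w)" using step.IH pu by simp
  note ts = tree_dist_step[OF step(4) assms(2)]
  from step(4) consider "child_edge v u" "\<not> w \<subseteq> v" | "child_edge u v" "w \<subseteq> u"
    | "top_split ord R v u" "w \<subseteq> u"
    unfolding next_step_def by blast
  then show ?case
  proof cases
    case 1
    note e = child_edgeD[OF 1(1)]
    show ?thesis
      using ts IH el e(2,3) rel_depth_eq[OF e(1,2) step.prems] next_step_parent(1)[OF 1 assms(2)] by simp
  next
    case 2
    note e = child_edgeD[OF 2(1)]
    have "\<not> (v \<noteq> R \<and> u = par v)" using parent_psubset[OF VC(1)] e(8) by blast
    then show ?thesis
      using ts IH el e(2,3) rel_depth_eq[OF e(1,2) pu] next_step_child(1,2)[OF 2 assms(2)] by auto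
  next
    case 3
    note e = top_splitD[OF 3(1)]
    show ?thesis
      using ts IH el e rel_depth_eq[OF e(1,2) step.prems] rel_depth_eq[OF e(4,5) pu]
        next_step_split(1,2)[OF 3 assms(2)] by simp
  qed
qed

text \<open>Neither depth is below that of the join, and since \<open>v\<close> and \<open>w\<close>
  differ, one of them lies strictly below the join and is strictly deeper.\<close>

lemma tree_dist_pos:
  assumes "v \<in> V" "w \<in> V" "proper v" "proper w" "v \<noteq> w"
  shows "0 < tree_dist ord R v w"
proof -
  have C: "v \<in> CC" "w \<in> CC" "v \<subseteq> R" "w \<subseteq> R" "v \<noteq> {}"
    using assms V_cluster cluster_subset cluster_nonempty by auto
  note Jp = cjoin_props[OF C(3-5)]
  have le: "rdepth (cjoin v w) \<le> rdepth s" if "s \<in> CC" "proper s" "s \<subseteq> cjoin v w" for s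
    using rdepth_strict[OF that(1) Jp(1) that(2)] that by force
  show ?thesis
  proof (cases "v = cjoin v w")
    case True
    then have "w \<subset> cjoin v w" using Jp assms(5) by blast
    then show ?thesis
      using rdepth_strict[OF C(2) Jp(1)] le[OF C(1)] assms Jp by (simp add: tree_dist_eq)
  next
    case False
    then have "v \<subset> cjoin v w" using Jp by blast
    then show ?thesis
      using rdepth_strict[OF C(1) Jp(1)] le[OF C(2)] assms Jp by (simp add: tree_dist_eq)
  qed
qed

subsection \<open>Quadruples of roots\<close>

text \<open>Every path from \<open>A\<close> to \<open>B\<close> runs through the gates \<open>v0\<close> and \<open>w0\<close>, so these are the endpoints of the unique
  shortest one.\<close>

lemma path_dist_gate:
  assumes "A \<subseteq> V" "B \<subseteq> V" "v0 \<in> A" "w0 \<in> B"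
    and sub: "\<And>v w. v \<in> A \<Longrightarrow> w \<in> B \<Longrightarrow> path_verts v0 w0 \<subseteq> path_verts v w"
    and gates: "path_verts v0 w0 \<inter> A = {v0}" "path_verts v0 w0 \<inter> B = {w0}"
  shows "path_dist ord R A B = tree_dist ord R v0 w0"
  unfolding path_dist_def
proof (rule the_equality)
  have len: "length (tree_path ord R v w) = card (path_verts v w)" if "v \<in> A" "w \<in> B" for v w
    using length_tree_path that assms(1,2) by (meson subsetD)
  have "length (tree_path ord R v0 w0) \<le> length (tree_path ord R v w)" if "v \<in> A" "w \<in> B" for v w
    using card_mono[OF finite_path_verts sub[OF that]] len that assms(3,4) by simp
  then show "\<exists>v\<in>A. \<exists>w\<in>B. tree_dist ord R v0 w0 = tree_dist ord R v w \<and>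
    (\<forall>v'\<in>A. \<forall>w'\<in>B. length (tree_path ord R v w) \<le> length (tree_path ord R v' w'))"
    using assms(3,4) by blast
  fix D
  assume "\<exists>v\<in>A. \<exists>w\<in>B. D = tree_dist ord R v w \<and>
    (\<forall>v'\<in>A. \<forall>w'\<in>B. length (tree_path ord R v w) \<le> length (tree_path ord R v' w'))"
  then obtain v w where vw: "v \<in> A" "w \<in> B" "D = tree_dist ord R v w"
    "length (tree_path ord R v w) \<le> length (tree_path ord R v0 w0)"
    using assms(3,4) by blast
  \<comment> \<open>The path between the gates is contained in this one, which is no longer, so the
    vertex sets agree and its ends lie on the path between the gates.\<close>
  then have "path_verts v0 w0 = path_verts v w"
    using card_seteq[OF finite_path_verts sub[OF vw(1,2)]] len assms(3,4) by simp
  moreover have "v \<in> path_verts v w" "w \<in> path_verts v w" using path_verts_ends[of v w] vw(1,2) assms(1,2) by auto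
  ultimately have "v \<in> path_verts v0 w0 \<inter> A" "w \<in> path_verts v0 w0 \<inter> B" using vw by auto
  then have "v = v0" "w = w0" unfolding gates by auto
  then show "D = tree_dist ord R v0 w0" using vw by simp
qed

section \<open>Paths between leaves and orders of \<open>(ij,kl)\<close>\<close>

lemma path_verts_leaf_iff: "t \<in> path_verts {a} {b} \<longleftrightarrow> t \<in> V \<and> ((a \<in> t) \<noteq> (b \<in> t) \<or> t = cjoin {a} {b})"
  by (auto simp: path_verts_def)

lemma cjoin_leaves:
  assumes "a \<in> R" "b \<in> R"
  shows "cjoin {a} {b} \<in> CC" "a \<in> cjoin {a} {b}" "b \<in> cjoin {a} {b}"
  using cjoin_props[of "{a}" "{b}"] assms by auto

lemma cjoin_leaves_least: "t \<in> CC \<Longrightarrow> a \<in> t \<Longrightarrow> b \<in> t \<Longrightarrow> cjoin {a} {b} \<subseteq> t"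
  by (rule cjoin_least) auto

lemma cjoin_leaves_proper: "a \<in> R \<Longrightarrow> b \<in> R \<Longrightarrow> a \<noteq> b \<Longrightarrow> proper (cjoin {a} {b})"
  using cjoin_leaves[of a b] proper_iff by blast

lemma cjoin_leaves_mem_iff:
  assumes "a \<in> R" "b \<in> R" "c \<in> R" "a \<noteq> b" "a \<noteq> c"
  shows "c \<in> cjoin {a} {b} \<longleftrightarrow> rord (a - b) \<le> rord (a - c)"
  using assms ord_minus_commute[of c a] by (simp add: cjoin_pair ord_eq)

lemma cjoin_leaves_rord:
  assumes "a \<in> R" "b \<in> R" "a \<noteq> b" "c \<in> cjoin {a} {b}" "e \<in> cjoin {a} {b}" "c \<noteq> e"
  shows "rord (a - b) \<le> rord (c - e)"
  using cjoin_pair_mem[OF assms(1-5)] assms by (simp add: ord_eq)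

lemma path_verts_leaf_below:
  assumes "t \<in> path_verts {a} {b}" "a \<in> R" "b \<in> R"
  shows "t \<subseteq> cjoin {a} {b}" "a \<in> t \<or> b \<in> t"
proof -
  note cjoin = cjoin_leaves[OF assms(2,3)]
  show ab: "a \<in> t \<or> b \<in> t" using assms(1) cjoin by (auto simp: path_verts_leaf_iff)
  have t: "t \<in> CC" using assms(1) V_cluster by (auto simp: path_verts_leaf_iff)
  have "t \<inter> cjoin {a} {b} \<noteq> {}" using ab cjoin by auto
  then have "t \<subseteq> cjoin {a} {b} \<or> cjoin {a} {b} \<subseteq> t" using laminar t cjoin(1) by simp
  then show "t \<subseteq> cjoin {a} {b}" using assms(1) cjoin by (auto simp: path_verts_leaf_iff)
qed

lemma rord_ultra: "a \<noteq> b \<Longrightarrow> b \<noteq> c \<Longrightarrow> a \<noteq> c \<Longrightarrow> min (rord (a - b)) (rord (b - c)) \<le> rord (a - c)"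
  using ord_add[of "a - b" "b - c"] by (simp add: ord_eq min_def split: if_splits)

lemma rord_cross_value:
  assumes "distinct [a, b, c, e]"
  shows "rord (cross_value a b c e) =
    rord (a - c) + rord (a - e) + rord (b - c) + rord (b - e) - 2 * rord (a - b) - 2 * rord (c - e)"
  unfolding cross_value_def using assms
  by (simp add: rord_divide rord_mult rord_power)

text \<open>A cluster containing a point of each of two disjoint clusters cannot lie inside either,
  so it contains both. The join may therefore be computed from any choice of points.\<close>

lemma cjoin_disjoint:
  assumes "u \<in> CC" "w \<in> CC" "u \<inter> w = {}" "a \<in> u" "c \<in> w"
  shows "cjoin u w = cjoin {a} {c}"
proof (rule cjoin_eqI)
  have R: "a \<in> R" "c \<in> R" using assms cluster_subset by auto
  note cjoin = cjoin_leaves[OF R]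
  have big: "u \<subseteq> t \<and> w \<subseteq> t" if t: "t \<in> CC" "a \<in> t" "c \<in> t" for t
  proof -
    have "t \<inter> u \<noteq> {}" "t \<inter> w \<noteq> {}" using assms(4,5) that by auto
    then have "t \<subseteq> u \<or> u \<subseteq> t" "t \<subseteq> w \<or> w \<subseteq> t" using laminar[OF t(1)] assms(1,2) by auto
    then show ?thesis using assms(3-5) that by auto
  qed
  show "cjoin {a} {c} \<in> CC" by (rule cjoin)
  show "u \<subseteq> cjoin {a} {c}" "w \<subseteq> cjoin {a} {c}" using big cjoin by auto
  show "cjoin {a} {c} \<subseteq> t" if "t \<in> CC" "u \<subseteq> t" "w \<subseteq> t" for t
    by (rule cjoin_leaves_least) (use that assms in auto)
qed

text \<open>A path from inside \<open>u\<close> to inside \<open>w\<close> must leave through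
  \<open>u\<close> and enter through \<open>w\<close>.\<close>

lemma path_verts_disjoint_mono:
  assumes "u \<in> CC" "w \<in> CC" "u \<inter> w = {}" "v \<in> CC" "z \<in> CC" "v \<subseteq> u" "z \<subseteq> w"
  shows "path_verts u w \<subseteq> path_verts v z"
proof
  fix t assume t: "t \<in> path_verts u w"
  then have tV: "t \<in> V" "t \<in> CC" using V_cluster by (auto simp: path_verts_def)
  obtain a where a: "a \<in> v" using cluster_nonempty[OF assms(4)] by auto
  obtain c where c: "c \<in> z" using cluster_nonempty[OF assms(5)] by auto
  have "cjoin u w = cjoin {a} {c}" "cjoin v z = cjoin {a} {c}"
    by (rule cjoin_disjoint; use assms a c in auto)+
  then have cjoin: "cjoin u w = cjoin v z" by simp
  have 1: "\<not> z \<subseteq> t" if "u \<subseteq> t" "\<not> w \<subseteq> t"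
  proof
    assume "z \<subseteq> t"
    then have "t \<inter> w \<noteq> {}" using c assms(7) by auto
    then have "t \<subseteq> w" using laminar[OF tV(2) assms(2)] that by auto
    then show False using that assms(3,6) a by auto
  qed
  have 2: "\<not> v \<subseteq> t" if "w \<subseteq> t" "\<not> u \<subseteq> t"
  proof
    assume "v \<subseteq> t"
    then have "t \<inter> u \<noteq> {}" using a assms(6) by auto
    then have "t \<subseteq> u" using laminar[OF tV(2) assms(1)] that by auto
    then show False using that assms(3,7) c by auto
  qed
  show "t \<in> path_verts v z"
    using t 1 2 assms(6,7) cjoin unfolding path_verts_def by auto
qed

text \<open>The last conjunct records that \<open>D\<close> occurs as the distance of two different
  proper vertices, so that it is one of the values enumerated by \<open>delta\<close>.\<close>

definition realises :: "'a set set \<Rightarrow> 'a set set \<Rightarrow> real \<Rightarrow> bool" where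
  "realises A B D \<longleftrightarrow> A \<inter> B = {} \<and> path_dist ord R A B = D \<and>
     (\<exists>v\<in>V. \<exists>w\<in>V. proper v \<and> proper w \<and> v \<noteq> w \<and> D = tree_dist ord R v w)"

text \<open>Both orders of \<open>A\<close> and \<open>B\<close> are obtained, so that later only
  one of two symmetric nestings needs an argument.\<close>

lemma realises_gates:
  assumes "A \<subseteq> V" "B \<subseteq> V" "A \<inter> B = {}" "v0 \<in> A" "w0 \<in> B" "proper v0" "proper w0"
    and "\<And>v w. v \<in> A \<Longrightarrow> w \<in> B \<Longrightarrow> path_verts v0 w0 \<subseteq> path_verts v w"
    and "path_verts v0 w0 \<inter> A = {v0}" "path_verts v0 w0 \<inter> B = {w0}"
    and "D = rdepth v0 + rdepth w0 - 2 * rdepth (cjoin v0 w0)"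
  shows "realises A B D \<and> realises B A D"
proof -
  have V: "v0 \<in> V" "w0 \<in> V" "v0 \<noteq> w0" using assms by auto
  have D: "D = tree_dist ord R v0 w0" "D = tree_dist ord R w0 v0"
    using assms V tree_dist_eq[of v0 w0] tree_dist_eq[of w0 v0] by (simp_all add: cjoin_commute)
  have "path_dist ord R A B = D" unfolding D(1) by (rule path_dist_gate) (use assms in auto)
  moreover have "path_dist ord R B A = D" unfolding D(2)
  proof (rule path_dist_gate)
    fix v w assume "v \<in> B" "w \<in> A"
    then show "path_verts w0 v0 \<subseteq> path_verts v w" using assms(8)[of w v] path_verts_commute[of w0 v0] path_verts_commute[of w v] by simp
  qed (use assms path_verts_commute[of w0 v0] in simp_all)
  ultimately show ?thesis
    unfolding realises_def using V D assms(3,6,7) by blast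
qed

text \<open>The gates are the two joins \<open>u\<close> and \<open>w\<close>. Neither is
  \<open>R\<close>, so both are vertices even if the root is removed.\<close>

lemma quad_disjoint:
  assumes "a \<in> R" "b \<in> R" "c \<in> R" "e \<in> R" "distinct [a, b, c, e]" "cjoin {a} {b} \<inter> cjoin {c} {e} = {}"
  shows "realises (path_verts {a} {b}) (path_verts {c} {e}) (- rord (cross_value a b c e) / 2)"
proof -
  define u w where "u = cjoin {a} {b}" and "w = cjoin {c} {e}"
  have u: "u \<in> CC" "a \<in> u" "b \<in> u" "proper u" and w: "w \<in> CC" "c \<in> w" "e \<in> w" "proper w"
    unfolding u_def w_def using cjoin_leaves cjoin_leaves_proper assms by auto
  have dis: "u \<inter> w = {}" using assms unfolding u_def w_def by simp
  have uw: "\<not> w \<subseteq> u" "\<not> u \<subseteq> w" using dis u w by auto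
  have V: "u \<in> V" "w \<in> V" using V_I u(1) w(1) uw cluster_subset by auto
  have A: "t \<subseteq> u" "t \<in> V" if "t \<in> path_verts {a} {b}" for t
    using path_verts_leaf_below(1)[OF that] that assms unfolding u_def by (auto simp: path_verts_leaf_iff)
  have B: "t \<subseteq> w" "t \<in> V" if "t \<in> path_verts {c} {e}" for t
    using path_verts_leaf_below(1)[OF that] that assms unfolding w_def by (auto simp: path_verts_leaf_iff)
  have uA: "u \<in> path_verts {a} {b}" and wB: "w \<in> path_verts {c} {e}" using V by (auto simp: path_verts_leaf_iff u_def w_def)
  have "path_verts {a} {b} \<inter> path_verts {c} {e} = {}"
  proof (rule equals0I)
    fix t assume "t \<in> path_verts {a} {b} \<inter> path_verts {c} {e}"
    then have "t \<subseteq> u \<inter> w" "t \<in> V" using A B by auto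
    then show False using dis V_cluster cluster_nonempty by auto
  qed
  moreover have "path_verts u w \<subseteq> path_verts v z" if "v \<in> path_verts {a} {b}" "z \<in> path_verts {c} {e}" for v z
    using path_verts_disjoint_mono[OF u(1) w(1) dis] A[OF that(1)] B[OF that(2)] V_cluster by simp
  moreover have "path_verts u w \<inter> path_verts {a} {b} = {u}" "path_verts u w \<inter> path_verts {c} {e} = {w}"
    using path_verts_ends[OF V] uA wB A B path_verts_superset[OF _ V] uw by blast+
  moreover have "- rord (cross_value a b c e) / 2 = rdepth u + rdepth w - 2 * rdepth (cjoin u w)"
  proof -
    \<comment> \<open>All four mixed differences have the same order, the depth of the join of
      \<open>u\<close> and \<open>w\<close>.\<close>
    have "rdepth (cjoin u w) = rord (p - q)" if "p \<in> u" "q \<in> w" for p q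
    proof -
      have "p \<in> R" "q \<in> R" "p \<noteq> q" using that u(1) w(1) cluster_subset dis by auto
      then show ?thesis using cjoin_disjoint[OF u(1) w(1) dis that] rdepth_cjoin_pair by simp
    qed
    from this[OF u(2) w(2)] this[OF u(2) w(3)] this[OF u(3) w(2)] this[OF u(3) w(3)] show ?thesis
      using rord_cross_value[OF assms(5)] rdepth_cjoin_pair[of a b] rdepth_cjoin_pair[of c e] assms
      by (simp add: u_def w_def)
  qed
  ultimately show ?thesis
    using A(2) B(2) uA wB u(4) w(4) realises_gates[of "path_verts {a} {b}" "path_verts {c} {e}" u w] by (simp add: subsetI)
qed

text \<open>The path from \<open>u\<close> upwards meets the path from \<open>c\<close> to
  \<open>e\<close> first at \<open>q\<close>, the join of \<open>a\<close> with \<open>c\<close>,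
  which is at least as close to \<open>a\<close> as \<open>e\<close> is. The gates are
  \<open>u\<close> and \<open>q\<close>, and since \<open>u\<close> lies below \<open>q\<close>,
  their distance is a difference of depths.\<close>

lemma quad_nested:
  assumes "a \<in> R" "b \<in> R" "c \<in> R" "e \<in> R" "distinct [a, b, c, e]" "cjoin {a} {b} \<subset> cjoin {c} {e}"
    and "c \<notin> cjoin {a} {b}" "e \<notin> cjoin {a} {b}" "rord (a - e) \<le> rord (a - c)"
  defines "D \<equiv> - rord (cross_value a b c e) / 2"
  shows "realises (path_verts {a} {b}) (path_verts {c} {e}) D \<and> realises (path_verts {c} {e}) (path_verts {a} {b}) D"
proof -
  define u w q where "u = cjoin {a} {b}" and "w = cjoin {c} {e}" and "q = cjoin {a} {c}"
  have u: "u \<in> CC" "a \<in> u" "b \<in> u" "proper u" and w: "w \<in> CC" "c \<in> w" "e \<in> w" "proper w"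
    and q: "q \<in> CC" "a \<in> q" "c \<in> q" "proper q"
    unfolding u_def w_def q_def using cjoin_leaves cjoin_leaves_proper assms by auto
  have ne: "a \<noteq> b" "a \<noteq> c" "a \<noteq> e" "b \<noteq> c" "b \<noteq> e" "c \<noteq> e" using assms(5) by auto
  have nu: "c \<notin> u" "e \<notin> u" and uw: "u \<subset> w" using assms unfolding u_def w_def by auto
  have above: "u \<subseteq> t" if "t \<in> CC" "t \<inter> u \<noteq> {}" "c \<in> t \<or> e \<in> t" for t
    using laminar[OF that(1) u(1) that(2)] that(3) nu by auto
  have uq: "u \<subseteq> q" by (rule above) (use q u in auto)
  have qw: "q \<subseteq> w" unfolding q_def by (rule cjoin_leaves_least) (use w u uw in auto)
  have qle: "q \<subseteq> t" if "t \<in> CC" "a \<in> t" "c \<in> t \<or> e \<in> t" for t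
  proof (cases "c \<in> t")
    case True then show ?thesis unfolding q_def using cjoin_leaves_least that by simp
  next
    case False
    then have "e \<in> t" using that by simp
    then have "cjoin {a} {e} \<subseteq> t" using cjoin_leaves_least that by simp
    moreover have "c \<in> cjoin {a} {e}" using cjoin_leaves_mem_iff[of a e c] assms ne by simp
    ultimately show ?thesis using False by auto
  qed
  have uV: "u \<in> V" using V_I u(1) uw w(1) cluster_subset by blast
  \<comment> \<open>If \<open>q\<close> were the removed root, the half containing \<open>a\<close>
    could contain neither \<open>c\<close> nor \<open>e\<close>. Both would lie in the other half,
    which would then contain \<open>w\<close> and so \<open>a\<close>.\<close>
  have qV: "q \<in> V"
  proof (rule ccontr)
    assume "q \<notin> V"
    then have qR: "q = R" "R \<notin> V" using V_I q(1) by auto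
    obtain s0 t0 where st0: "top_split ord R s0 t0" using R_notin_V_obtain[OF qR(2)] .
    obtain s t where st: "top_split ord R s t" "a \<in> s"
      using st0 assms(1) top_splitD(8)[OF st0] top_split_commute[of s0 t0] by auto
    note st' = top_splitD[OF st(1)]
    have "\<not> q \<subseteq> s" using qR st'(1,2) cluster_subset by auto
    then have "c \<notin> s" "e \<notin> s" using qle[OF st'(1) st(2)] by auto
    then have "c \<in> t" "e \<in> t" using st'(8) assms(3,4) by auto
    then have "w \<subseteq> t" unfolding w_def using cjoin_leaves_least st'(4) by simp
    then show False using st'(7) uw u(2) st(2) by auto
  qed
  have A: "t \<subseteq> u" "t \<in> V" if "t \<in> path_verts {a} {b}" for t
    using path_verts_leaf_below(1)[OF that] that assms unfolding u_def by (auto simp: path_verts_leaf_iff)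
  have B: "c \<in> t \<or> e \<in> t" "t \<in> V" if "t \<in> path_verts {c} {e}" for t
    using path_verts_leaf_below(2)[OF that] that assms by (auto simp: path_verts_leaf_iff)
  have uA: "u \<in> path_verts {a} {b}" using uV by (auto simp: path_verts_leaf_iff u_def)
  have qB: "q \<in> path_verts {c} {e}"
  proof (cases "e \<in> q")
    case True
    then have "w \<subseteq> q" unfolding w_def using cjoin_leaves_least q by simp
    then have "q = w" using qw by auto
    then show ?thesis using qV by (simp add: path_verts_leaf_iff w_def)
  next
    case False then show ?thesis using qV q by (simp add: path_verts_leaf_iff)
  qed
  have Juq: "cjoin u q = q" using cjoin_absorb[OF q(1) uq] cjoin_commute by metis
  have mid: "c \<notin> t \<and> e \<notin> t \<and> u \<subseteq> t" if "t \<in> path_verts u q" "t \<noteq> q" for t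
  proof -
    have t: "t \<in> V" "t \<in> CC" "u \<subseteq> t" "\<not> q \<subseteq> t"
      using that uq V_cluster unfolding path_verts_def Juq by auto
    then show ?thesis using qle[OF t(2)] u(2) by auto
  qed
  have "path_verts {a} {b} \<inter> path_verts {c} {e} = {}"
  proof (rule equals0I)
    fix t assume "t \<in> path_verts {a} {b} \<inter> path_verts {c} {e}"
    then have "t \<subseteq> u" "c \<in> t \<or> e \<in> t" using A(1) B(1) by auto
    then show False using nu by auto
  qed
  moreover have "path_verts u q \<subseteq> path_verts v z" if "v \<in> path_verts {a} {b}" "z \<in> path_verts {c} {e}" for v z
  proof
    fix t assume t: "t \<in> path_verts u q"
    then have tV: "t \<in> V" by (auto simp: path_verts_def)
    note v = A[OF that(1)] and z = B[OF that(2)]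
    show "t \<in> path_verts v z"
    proof (cases "t = q")
      case False
      then have "\<not> z \<subseteq> t" "v \<subseteq> t" using mid[OF t] v z by auto
      then show ?thesis using tV by (auto simp: path_verts_def)
    next
      case True
      have vq: "v \<subseteq> q" using v uq by auto
      show ?thesis
      proof (cases "z \<subseteq> q")
        case True
        have "cjoin v z = q"
        proof (rule cjoin_eqI)
          fix t assume t: "t \<in> CC" "v \<subseteq> t" "z \<subseteq> t"
          have "v \<noteq> {}" using v(2) V_cluster cluster_nonempty by auto
          then have "u \<subseteq> t" using above[OF t(1)] t v(1) z(1) by auto
          then show "q \<subseteq> t" using qle[OF t(1)] u(2) z(1) t(3) by auto
        qed (use q vq True in auto)
        then show ?thesis using \<open>t = q\<close> tV by (simp add: path_verts_def)
      next
        case False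
        then show ?thesis using \<open>t = q\<close> tV vq by (simp add: path_verts_def)
      qed
    qed
  qed
  moreover have "path_verts u q \<inter> path_verts {a} {b} = {u}"
  proof -
    have "t = u" if "t \<in> path_verts u q" "t \<in> path_verts {a} {b}" for t
      using path_verts_superset[OF that(1) uV qV] A[OF that(2)] uq by auto
    then show ?thesis using path_verts_ends[OF uV qV] uA by auto
  qed
  moreover have "path_verts u q \<inter> path_verts {c} {e} = {q}"
    using mid B path_verts_ends[OF uV qV] qB by auto
  moreover have "D = rdepth u + rdepth q - 2 * rdepth (cjoin u q)"
  proof -
    have lt: "rord (a - c) < rord (a - b)" "rord (a - e) < rord (a - b)"
      using cjoin_leaves_mem_iff[of a b c] cjoin_leaves_mem_iff[of a b e] assms ne nu unfolding u_def by auto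
    have 1: "rord (b - c) = rord (a - c)"
      using rord_ultra[of a b c] rord_ultra[of b a c] ne lt rord_minus_commute[of b a] by auto
    have 2: "rord (b - e) = rord (a - e)"
      using rord_ultra[of a b e] rord_ultra[of b a e] ne lt rord_minus_commute[of b a] by auto
    have "rord (c - e) \<le> rord (a - e)"
      using cjoin_leaves_rord[of c e a e] assms(3,4) ne w u uw unfolding w_def by auto
    \<comment> \<open>The triangle \<open>a\<close>, \<open>c\<close>, \<open>e\<close> is
      isosceles, with its two smallest orders at \<open>e\<close>. The terms in
      \<open>rord (a - e)\<close> then cancel in the order of \<open>cross_value\<close>.\<close>
    then have 3: "rord (c - e) = rord (a - e)"
      using rord_ultra[of c a e] ne assms(9) rord_minus_commute[of c a] by auto
    have "rdepth u = rord (a - b)" "rdepth q = rord (a - c)"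
      using rdepth_cjoin_pair[of a b] rdepth_cjoin_pair[of a c] assms ne unfolding u_def q_def by auto
    then show ?thesis unfolding D_def Juq using rord_cross_value[OF assms(5)] 1 2 3 by simp
  qed
  ultimately show ?thesis
    using A(2) B(2) uA qB u(4) q(4) realises_gates[of "path_verts {a} {b}" "path_verts {c} {e}" u q] by (simp add: subsetI)
qed

lemma cross_value_swap:
  assumes "distinct [a, b, c, e]"
  shows "rord (cross_value a b e c) = rord (cross_value a b c e)"
    "rord (cross_value c e a b) = rord (cross_value a b c e)"
  using rord_cross_value[of a b c e] rord_cross_value[of a b e c] rord_cross_value[of c e a b] assms
    rord_minus_commute[of e c] rord_minus_commute[of c a] rord_minus_commute[of c b]
    rord_minus_commute[of e a] rord_minus_commute[of e b] by auto

text \<open>The inner join \<open>u\<close> contains \<open>c\<close> but not \<open>e\<close>, so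
  it separates them and lies on both paths.\<close>

lemma quad_subset_meet:
  assumes "a \<in> R" "b \<in> R" "c \<in> R" "e \<in> R" "distinct [a, b, c, e]" "cjoin {a} {b} \<subset> cjoin {c} {e}"
    and "c \<in> cjoin {a} {b}"
  shows "path_verts {a} {b} \<inter> path_verts {c} {e} \<noteq> {}" "0 \<le> rord (cross_value a b c e)"
proof -
  define u w where "u = cjoin {a} {b}" and "w = cjoin {c} {e}"
  have u: "u \<in> CC" "a \<in> u" "b \<in> u" and w: "w \<in> CC" "c \<in> w" "e \<in> w"
    unfolding u_def w_def using cjoin_leaves assms by auto
  have ne: "a \<noteq> b" "a \<noteq> c" "a \<noteq> e" "b \<noteq> c" "b \<noteq> e" "c \<noteq> e" using assms(5) by auto
  have uw: "u \<subset> w" "c \<in> u" using assms unfolding u_def w_def by auto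
  have uV: "u \<in> V" using V_I u(1) uw w(1) cluster_subset by blast
  have "e \<notin> u" using cjoin_leaves_least[OF u(1), of c e] uw unfolding w_def by auto
  then have "u \<in> path_verts {a} {b} \<inter> path_verts {c} {e}" using uV uw by (auto simp: path_verts_leaf_iff u_def)
  then show "path_verts {a} {b} \<inter> path_verts {c} {e} \<noteq> {}" by blast
  have "rord (a - b) \<le> rord (a - c)" "rord (a - b) \<le> rord (b - c)"
    using cjoin_leaves_rord[of a b a c] cjoin_leaves_rord[of a b b c] assms ne u unfolding u_def by auto
  moreover have "rord (c - e) \<le> rord (a - e)" "rord (c - e) \<le> rord (b - e)"
    using cjoin_leaves_rord[of c e a e] cjoin_leaves_rord[of c e b e] assms(3,4) ne u uw w unfolding w_def by auto
  ultimately show "0 \<le> rord (cross_value a b c e)" using rord_cross_value[OF assms(5)] by simp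
qed

text \<open>The common join lies on both paths if it is a vertex. If it is the removed root, each
  pair has one member in each half of the split, so both paths pass through the half
  \<open>s\<close>.\<close>

lemma quad_equal_meet:
  assumes "a \<in> R" "b \<in> R" "c \<in> R" "e \<in> R" "distinct [a, b, c, e]" "cjoin {a} {b} = cjoin {c} {e}"
  shows "path_verts {a} {b} \<inter> path_verts {c} {e} \<noteq> {}" "0 \<le> rord (cross_value a b c e)"
proof -
  define u where "u = cjoin {a} {b}"
  have u: "u \<in> CC" "a \<in> u" "b \<in> u" "c \<in> u" "e \<in> u" "u = cjoin {c} {e}"
    unfolding u_def using cjoin_leaves[of a b] cjoin_leaves[of c e] assms by auto
  have ne: "a \<noteq> b" "a \<noteq> c" "a \<noteq> e" "b \<noteq> c" "b \<noteq> e" "c \<noteq> e" using assms(5) by auto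
  have "rord (a - b) \<le> rord (a - c)" "rord (a - b) \<le> rord (b - e)"
    using cjoin_leaves_rord[of a b a c] cjoin_leaves_rord[of a b b e] assms(1,2) ne u unfolding u_def by auto
  moreover have "rord (c - e) \<le> rord (a - e)" "rord (c - e) \<le> rord (b - c)"
    using cjoin_leaves_rord[of c e a e] cjoin_leaves_rord[of c e b c] assms(3,4) ne u by auto
  ultimately show "0 \<le> rord (cross_value a b c e)" using rord_cross_value[OF assms(5)] by simp
  show "path_verts {a} {b} \<inter> path_verts {c} {e} \<noteq> {}"
  proof (cases "u \<in> V")
    case True
    then have "u \<in> path_verts {a} {b} \<inter> path_verts {c} {e}" using u by (auto simp: path_verts_leaf_iff u_def)
    then show ?thesis by blast
  next
    case False
    then have uR: "u = R" "R \<notin> V" using V_I u(1) by auto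
    obtain s t where st: "top_split ord R s t" using R_notin_V_obtain[OF uR(2)] .
    note st' = top_splitD[OF st]
    have no: "\<not> R \<subseteq> s" "\<not> R \<subseteq> t" using st'(1,2,4,5) cluster_subset by auto
    have "\<not> (a \<in> s \<and> b \<in> s)" "\<not> (a \<in> t \<and> b \<in> t)" "\<not> (c \<in> s \<and> e \<in> s)" "\<not> (c \<in> t \<and> e \<in> t)"
      using cjoin_leaves_least[OF st'(1), of a b] cjoin_leaves_least[OF st'(4), of a b]
        cjoin_leaves_least[OF st'(1), of c e] cjoin_leaves_least[OF st'(4), of c e] no uR(1) u(6) u_def by auto
    moreover have "a \<in> s \<union> t" "b \<in> s \<union> t" "c \<in> s \<union> t" "e \<in> s \<union> t" using st'(8) assms by auto
    ultimately have "(a \<in> s) \<noteq> (b \<in> s)" "(c \<in> s) \<noteq> (e \<in> s)" by auto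
    then have "s \<in> path_verts {a} {b} \<inter> path_verts {c} {e}" using V_I[OF st'(1,2)] by (simp add: path_verts_leaf_iff)
    then show ?thesis by blast
  qed
qed

text \<open>By \<open>laminar\<close> the two joins are disjoint, equal or strictly nested. In the
  nested case, exchanging \<open>c\<close> with \<open>e\<close> or the two pairs reduces to the
  configurations treated above.\<close>

lemma quad_cases:
  assumes "a \<in> R" "b \<in> R" "c \<in> R" "e \<in> R" "distinct [a, b, c, e]"
  shows "realises (path_verts {a} {b}) (path_verts {c} {e}) (- rord (cross_value a b c e) / 2) \<or>
    (path_verts {a} {b} \<inter> path_verts {c} {e} \<noteq> {} \<and> 0 \<le> rord (cross_value a b c e))"
proof -
  have nested: "(realises (path_verts {a} {b}) (path_verts {c} {e}) (- rord (cross_value a b c e) / 2) \<and>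
        realises (path_verts {c} {e}) (path_verts {a} {b}) (- rord (cross_value a b c e) / 2)) \<or>
      (path_verts {a} {b} \<inter> path_verts {c} {e} \<noteq> {} \<and> 0 \<le> rord (cross_value a b c e))"
    if abce: "a \<in> R" "b \<in> R" "c \<in> R" "e \<in> R" "distinct [a, b, c, e]" "cjoin {a} {b} \<subset> cjoin {c} {e}" for a b c e
  proof -
    have dis: "distinct [a, b, e, c]" using abce by auto
    have sub: "cjoin {a} {b} \<subset> cjoin {e} {c}" using abce(6) cjoin_commute by metis
    have swap: "path_verts {e} {c} = path_verts {c} {e}" "rord (cross_value a b e c) = rord (cross_value a b c e)"
      using path_verts_commute cross_value_swap abce by auto
    consider "c \<in> cjoin {a} {b}" | "e \<in> cjoin {a} {b}"
      | "c \<notin> cjoin {a} {b}" "e \<notin> cjoin {a} {b}" "rord (a - e) \<le> rord (a - c)"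
      | "c \<notin> cjoin {a} {b}" "e \<notin> cjoin {a} {b}" "rord (a - c) \<le> rord (a - e)" by linarith
    then show ?thesis
    proof cases
      case 1 then show ?thesis using quad_subset_meet[OF abce] by simp
    next
      case 2 then show ?thesis using quad_subset_meet[OF abce(1,2,4,3) dis sub] swap by simp
    next
      case 3 then show ?thesis using quad_nested[OF abce] by simp
    next
      case 4 then show ?thesis using quad_nested[OF abce(1,2,4,3) dis sub] swap by simp
    qed
  qed
  have dis: "distinct [c, e, a, b]" using assms by auto
  consider "cjoin {a} {b} \<inter> cjoin {c} {e} = {}" | "cjoin {a} {b} = cjoin {c} {e}" | "cjoin {a} {b} \<subset> cjoin {c} {e}"
    | "cjoin {c} {e} \<subset> cjoin {a} {b}"
    using laminar[OF cjoin_leaves(1)[of a b] cjoin_leaves(1)[of c e]] assms by auto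
  then show ?thesis
  proof cases
    case 1 then show ?thesis using quad_disjoint assms by simp
  next
    case 2 then show ?thesis using quad_equal_meet assms by simp
  next
    case 3 then show ?thesis using nested[OF assms] by blast
  next
    case 4
    then show ?thesis
      using nested[OF assms(3,4,1,2) dis 4] cross_value_swap(2)[OF assms(5)] by (auto simp: Int_commute)
  qed
qed

end

section \<open>The order of the invariants\<close>

lemma sum_level_set_less:
  fixes q :: "'p \<Rightarrow> real"
  assumes "finite U" "T' \<subseteq> U" "card T' = card {P \<in> U. q P \<le> c}" "T' \<noteq> {P \<in> U. q P \<le> c}"
  shows "sum q {P \<in> U. q P \<le> c} < sum q T'"
proof -
  define T where "T = {P \<in> U. q P \<le> c}"
  have fin: "finite T" "finite T'" using assms(1,2) finite_subset by (auto simp: T_def)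
  have "\<not> T' \<subseteq> T" using card_subset_eq[OF fin(1)] assms(3,4) by (auto simp: T_def)
  then have ne: "T' - T \<noteq> {}" by auto
  have card: "card (T' - T) = card (T - T')"
    using card_Diff_subset_Int[of T' T] card_Diff_subset_Int[of T T'] fin assms(3)
    by (simp add: T_def Int_commute)
  have "sum q (T - T') \<le> real (card (T - T')) * c"
    using sum_bounded_above[of "T - T'" q c] by (simp add: T_def)
  also have "\<dots> = (\<Sum>P\<in>T' - T. c)" by (simp add: card)
  also have "\<dots> < sum q (T' - T)"
    by (rule sum_strict_mono) (use ne fin assms(2) in \<open>auto simp: T_def\<close>)
  finally have "sum q (T - T') + sum q (T \<inter> T') < sum q (T' - T) + sum q (T \<inter> T')" by simp
  moreover have "sum q T = sum q (T - T') + sum q (T \<inter> T')"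
    using fin sum.Int_Diff[of T q T'] by simp
  moreover have "sum q T' = sum q (T' - T) + sum q (T \<inter> T')"
    using fin sum.Int_Diff[of T' q T] by (simp add: Int_commute)
  ultimately show ?thesis by (simp add: T_def)
qed

text \<open>The term \<open>a m\<close> occurs in the partial sums with
  \<open>m \<le> k \<le> n\<close>, which are \<open>n - m + 1\<close> in number; this is the
  exponent in \<open>R_fun\<close>.\<close>

lemma sum_partial_sums:
  fixes a :: "nat \<Rightarrow> real"
  shows "(\<Sum>k=1..n. \<Sum>m=1..k. a m) = (\<Sum>m=1..n. real (n - m + 1) * a m)"
proof (induction n)
  case (Suc n)
  have "(\<Sum>m=1..n. real (Suc n - m + 1) * a m) = (\<Sum>m=1..n. real (n - m + 1) * a m + a m)"
    by (rule sum.cong) (auto simp: Suc_diff_le algebra_simps)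
  then show ?case using Suc by (simp add: sum.distrib)
qed simp

lemma rev_sorted_list_of_set_nth:
  fixes D :: "real set"
  assumes "finite D"
  defines "l \<equiv> (\<lambda>m. rev (sorted_list_of_set D) ! (m - 1))"
  shows "l ` {1..card D} = D" "\<And>i j. 1 \<le> i \<Longrightarrow> i < j \<Longrightarrow> j \<le> card D \<Longrightarrow> l j < l i"
proof -
  let ?L = "rev (sorted_list_of_set D)"
  have len: "length ?L = card D" using assms by simp
  have "D = set ?L" using assms by simp
  also have "\<dots> = (\<lambda>i. ?L ! i) ` {..<card D}" by (auto simp: set_conv_nth len simp del: rev_nth length_rev)
  \<comment> \<open>List positions start at \<open>0\<close>, whereas the values are numbered from
    \<open>1\<close>.\<close>
  also have "{..<card D} = (\<lambda>m. m - 1) ` {1..card D}"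
    by (force simp: image_iff)
  finally show "l ` {1..card D} = D" unfolding l_def by (simp add: image_image)
  have "sorted_wrt (<) (sorted_list_of_set D)" by (simp add: strict_sorted_iff)
  then have *: "sorted_list_of_set D ! a < sorted_list_of_set D ! b" if "a < b" "b < card D" for a b
    using sorted_wrt_nth_less[of "(<)" "sorted_list_of_set D" a b] that assms by simp
  show "l j < l i" if "1 \<le> i" "i < j" "j \<le> card D" for i j
    unfolding l_def using that assms *[of "card D - j" "card D - i"] by (simp add: rev_nth)
qed

section \<open>The sets \<open>S_pairs\<close> as level sets of the order\<close>

locale labelled_roots =
  fixes ord :: "'a::field \<Rightarrow> ereal" and d :: nat and x :: "nat \<Rightarrow> 'a"
  assumes valuation: "valuation ord" and inj: "inj_on x {1..d}" and d_pos: "1 \<le> d"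
begin

sublocale root_set ord "x ` {1..d}"
  by unfold_locales (use valuation d_pos in auto)

abbreviation "DV \<equiv> dist_values ord d x"
abbreviation "\<delta> \<equiv> delta ord d x"

lemma DV_eq: "DV = {tree_dist ord (x ` {1..d}) v w |v w. v \<in> V \<and> w \<in> V \<and> proper v \<and> proper w \<and> v \<noteq> w}"
  by (simp add: dist_values_def Let_def)

lemma finite_DV: "finite DV"
proof (rule finite_subset)
  show "DV \<subseteq> (\<lambda>(v, w). tree_dist ord (x ` {1..d}) v w) ` (V \<times> V)" unfolding DV_eq by auto
qed (use finite_V in simp)

lemma DV_pos: "D \<in> DV \<Longrightarrow> 0 < D"
  unfolding DV_eq using tree_dist_pos by blast

lemma delta_image: "\<delta> ` {1..card DV} = DV"
  and delta_less: "1 \<le> i \<Longrightarrow> i < j \<Longrightarrow> j \<le> card DV \<Longrightarrow> \<delta> j < \<delta> i"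
  unfolding delta_def using rev_sorted_list_of_set_nth[OF finite_DV] by auto

lemma delta_pos: "m \<in> {1..card DV} \<Longrightarrow> 0 < \<delta> m"
  using delta_image DV_pos by blast

definition quad_ord :: "nat set set \<Rightarrow> real" where
  "quad_ord P = rord (ratfun_eval x (cross_pair P))"

lemma x_eq_iff: "i \<in> {1..d} \<Longrightarrow> j \<in> {1..d} \<Longrightarrow> x i = x j \<longleftrightarrow> i = j"
  using inj by (simp add: inj_on_eq_iff)

lemma eval_cross_pair:
  assumes "{i, j, k, l} \<subseteq> {1..d}" "distinct [i, j, k, l]"
  shows "regular_at x (cross_pair {{i, j}, {k, l}})"
    "ratfun_eval x (cross_pair {{i, j}, {k, l}}) = cross_value (x i) (x j) (x k) (x l)"
    "distinct [x i, x j, x k, x l]"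
proof -
  show dis: "distinct [x i, x j, x k, x l]" using assms by (auto simp: x_eq_iff)
  show "regular_at x (cross_pair {{i, j}, {k, l}})"
    "ratfun_eval x (cross_pair {{i, j}, {k, l}}) = cross_value (x i) (x j) (x k) (x l)"
    unfolding cross_pair_eq[OF assms(2)] using ratfun_eval_cross[of x i j k l] dis by auto
qed

lemma eval_quad:
  assumes "P \<in> quads d"
  shows "regular_at x (cross_pair P)" "ratfun_eval x (cross_pair P) \<noteq> 0"
proof -
  obtain i j k l where P: "P = {{i, j}, {k, l}}" "{i, j, k, l} \<subseteq> {1..d}" "distinct [i, j, k, l]"
    using assms by (auto simp: quads_def)
  note e = eval_cross_pair[OF P(2,3)]
  show "regular_at x (cross_pair P)" unfolding P(1) by (rule e)
  show "ratfun_eval x (cross_pair P) \<noteq> 0" unfolding P(1) e(2) cross_value_def using e(3) by auto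
qed

lemma leaf_path_eq:
  assumes "i \<in> {1..d}" "j \<in> {1..d}" "i \<noteq> j"
  shows "leaf_path ord d x i j = path_verts {x i} {x j}"
proof -
  have ne: "x i \<noteq> x j" using assms x_eq_iff by simp
  have "x i \<in> x ` {1..d}" "x j \<in> x ` {1..d}" using assms by auto
  then have "{x i} \<noteq> x ` {1..d}" "{x j} \<noteq> x ` {1..d}" using ne by (metis singletonD)+
  then have "{x i} \<in> V" "{x j} \<in> V" using V_I singleton_cluster assms by auto
  then show ?thesis unfolding leaf_path_def by (rule set_tree_path)
qed

lemma quad_dist:
  assumes "{i, j, k, l} \<subseteq> {1..d}" "distinct [i, j, k, l]"
  defines "A \<equiv> leaf_path ord d x i j" and "B \<equiv> leaf_path ord d x k l" and "P \<equiv> {{i, j}, {k, l}}"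
  shows "(A \<inter> B = {} \<and> path_dist ord (x ` {1..d}) A B = - quad_ord P / 2 \<and> - quad_ord P / 2 \<in> DV) \<or> (A \<inter> B \<noteq> {} \<and> 0 \<le> quad_ord P)"
proof -
  have AB: "A = path_verts {x i} {x j}" "B = path_verts {x k} {x l}" using assms leaf_path_eq by auto
  have quad_ord: "quad_ord P = rord (cross_value (x i) (x j) (x k) (x l))"
    unfolding quad_ord_def P_def eval_cross_pair(2)[OF assms(1,2)] ..
  have "realises A B (- quad_ord P / 2) \<or> (A \<inter> B \<noteq> {} \<and> 0 \<le> quad_ord P)"
    unfolding AB quad_ord by (rule quad_cases) (use assms(1) eval_cross_pair(3)[OF assms(1,2)] in auto)
  then show ?thesis unfolding realises_def DV_eq by auto
qed

lemma quad_ord_neg: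
  assumes "P \<in> quads d" "quad_ord P < 0" shows "- quad_ord P / 2 \<in> DV"
proof -
  obtain i j k l where P: "P = {{i, j}, {k, l}}" "{i, j, k, l} \<subseteq> {1..d}" "distinct [i, j, k, l]"
    using assms(1) by (auto simp: quads_def)
  show ?thesis using quad_dist[OF P(2,3)] assms(2) unfolding P(1) by linarith
qed

text \<open>As \<open>\<delta> m\<close> is positive, an order of \<open>- 2 * \<delta> m\<close> is
  negative. This excludes meeting paths, and for disjoint paths \<open>quad_dist\<close> identifies
  the distance.\<close>

lemma S_pairs_eq:
  assumes "m \<in> {1..card DV}"
  shows "S_pairs ord d x m = {P \<in> quads d. quad_ord P = - 2 * \<delta> m}"
proof -
  have key: "(leaf_path ord d x i j \<inter> leaf_path ord d x k l = {} \<and>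
      path_dist ord (x ` {1..d}) (leaf_path ord d x i j) (leaf_path ord d x k l) = \<delta> m) \<longleftrightarrow>
      quad_ord {{i, j}, {k, l}} = - 2 * \<delta> m"
    if "{i, j, k, l} \<subseteq> {1..d}" "distinct [i, j, k, l]" for i j k l
    using quad_dist[OF that] delta_pos[OF assms] by auto
  show ?thesis
  proof (intro equalityI subsetI)
    fix P assume "P \<in> S_pairs ord d x m"
    then obtain i j k l where P: "P = {{i, j}, {k, l}}" "{i, j, k, l} \<subseteq> {1..d}" "distinct [i, j, k, l]"
      "leaf_path ord d x i j \<inter> leaf_path ord d x k l = {}"
      "path_dist ord (x ` {1..d}) (leaf_path ord d x i j) (leaf_path ord d x k l) = \<delta> m"
      unfolding S_pairs_def by (elim CollectE exE conjE)
    have "P \<in> quads d" unfolding quads_def P(1) using P(2,3) by blast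
    then show "P \<in> {P \<in> quads d. quad_ord P = - 2 * \<delta> m}" using key[OF P(2,3)] P by simp
  next
    fix P assume "P \<in> {P \<in> quads d. quad_ord P = - 2 * \<delta> m}"
    then have P': "P \<in> quads d" "quad_ord P = - 2 * \<delta> m" by auto
    from P'(1) obtain i j k l where P: "P = {{i, j}, {k, l}}" "{i, j, k, l} \<subseteq> {1..d}" "distinct [i, j, k, l]"
      unfolding quads_def by (elim CollectE exE conjE)
    have "leaf_path ord d x i j \<inter> leaf_path ord d x k l = {} \<and>
      path_dist ord (x ` {1..d}) (leaf_path ord d x i j) (leaf_path ord d x k l) = \<delta> m"
      using key[OF P(2,3)] P'(2) unfolding P(1) by blast
    with P(2,3) show "P \<in> S_pairs ord d x m"
      unfolding S_pairs_def P(1)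
      by (intro CollectI exI[of _ i] exI[of _ j] exI[of _ k] exI[of _ l] conjI refl) (elim conjE, assumption)+
  qed
qed

section \<open>Sublevel sets of the order\<close>

definition top_pairs :: "nat \<Rightarrow> nat set set set" where
  "top_pairs k = (\<Union>m\<in>{1..k}. S_pairs ord d x m)"

text \<open>A pair of order at most \<open>- 2 * \<delta> k\<close> has negative order, hence
  belongs to some level \<open>m\<close> by \<open>quad_ord_neg\<close>; as \<open>\<delta>\<close>
  is strictly decreasing, \<open>m \<le> k\<close>.\<close>

lemma top_pairs_eq:
  assumes "k \<in> {1..card DV}"
  shows "top_pairs k = {P \<in> quads d. quad_ord P \<le> - 2 * \<delta> k}"
proof -
  have "P \<in> top_pairs k \<longleftrightarrow> quad_ord P \<le> - 2 * \<delta> k" if P: "P \<in> quads d" for P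
  proof
    assume "P \<in> top_pairs k"
    then obtain m where "m \<in> {1..k}" "quad_ord P = - 2 * \<delta> m" using S_pairs_eq assms by (auto simp: top_pairs_def)
    then show "quad_ord P \<le> - 2 * \<delta> k" using delta_less[of m k] assms by (cases "m = k") auto
  next
    assume le: "quad_ord P \<le> - 2 * \<delta> k"
    then have "quad_ord P < 0" using delta_pos[OF assms] by simp
    then obtain m where m: "m \<in> {1..card DV}" "- quad_ord P / 2 = \<delta> m" using quad_ord_neg[OF P] delta_image by (metis imageE)
    then have "m \<le> k" using delta_less[of k m] le assms by (force simp: not_le[symmetric])
    moreover have "P \<in> S_pairs ord d x m" using m P S_pairs_eq[OF m(1)] by simp
    ultimately show "P \<in> top_pairs k" unfolding top_pairs_def using m(1) by auto
  qed
  moreover have "top_pairs k \<subseteq> quads d" using S_pairs_eq assms by (auto simp: top_pairs_def)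
  ultimately show ?thesis by blast
qed

lemma S_pairs_disjoint:
  assumes "i \<in> {1..card DV}" "j \<in> {1..card DV}" "i \<noteq> j"
  shows "S_pairs ord d x i \<inter> S_pairs ord d x j = {}"
proof -
  have "\<delta> i \<noteq> \<delta> j" using delta_less[of i j] delta_less[of j i] assms by (cases "i < j") auto
  then show ?thesis using S_pairs_eq assms by auto
qed

lemma finite_S_pairs: "m \<in> {1..card DV} \<Longrightarrow> finite (S_pairs ord d x m)"
  using S_pairs_eq finite_quads by simp

lemma weighted_sum_S_pairs:
  assumes "n \<le> card DV"
  shows "(\<Sum>m=1..n. real (n - m + 1) * sum h (S_pairs ord d x m)) = (\<Sum>k=1..n. sum h (top_pairs k))"
proof -
  have "sum h (top_pairs k) = (\<Sum>m=1..k. sum h (S_pairs ord d x m))" if "k \<in> {1..n}" for k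
    unfolding top_pairs_def
    by (rule sum.UNION_disjoint) (use that assms finite_S_pairs S_pairs_disjoint in auto)
  then show ?thesis using sum_partial_sums[of "\<lambda>m. sum h (S_pairs ord d x m)" n] by simp
qed

section \<open>The effect of permutations on \<open>R_fun\<close>\<close>

abbreviation act :: "(nat \<Rightarrow> nat) \<Rightarrow> nat set set \<Rightarrow> nat set set" where
  "act \<sigma> \<equiv> (`) ((`) \<sigma>)"

lemma inj_act:
  assumes "\<sigma> permutes {1..d}" shows "inj (act \<sigma>)"
proof -
  have "inj ((`) \<sigma>)" using permutes_inj[OF assms] by (auto intro: injI simp: inj_image_eq_iff)
  then show ?thesis by (auto intro: injI simp: inj_image_eq_iff)
qed

lemma perm_act_R_fun:
  assumes "\<sigma> permutes {1..d}" "n \<le> card DV"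
  shows "perm_act \<sigma> (R_fun ord d x n) =
      (\<Prod>m=1..n. \<Prod>P\<in>S_pairs ord d x m. cross_pair (act \<sigma> P) ^ (n - m + 1))"
proof -
  have P: "regular_at (\<lambda>i. X_var (\<sigma> i)) (cross_pair P)"
    "ratfun_eval (\<lambda>i. X_var (\<sigma> i)) (cross_pair P) = cross_pair (act \<sigma> P)"
    if "m \<in> {1..n}" "P \<in> S_pairs ord d x m" for m P
    using perm_act_cross_pair[OF assms(1), of P] that S_pairs_eq[of m] assms(2)
    by (auto simp: perm_act_def)
  have "perm_act \<sigma> (R_fun ord d x n) = (\<Prod>m=1..n. \<Prod>P\<in>S_pairs ord d x m.
      ratfun_eval (\<lambda>i. X_var (\<sigma> i)) (cross_pair P) ^ (n - m + 1))"
    unfolding perm_act_def R_fun_def by (rule ratfun_eval_prod_power(2)) (rule P(1))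
  also have "\<dots> = (\<Prod>m=1..n. \<Prod>P\<in>S_pairs ord d x m. cross_pair (act \<sigma> P) ^ (n - m + 1))"
    by (intro prod.cong refl arg_cong2[of _ _ _ _ "(^)"] P(2))
  finally show ?thesis .
qed

text \<open>The weights \<open>n - m + 1\<close> turn the order of the product into a sum over
  sublevel sets, and the injective \<open>act \<sigma>\<close> moves each of these as a
  whole.\<close>

lemma eval_perm_act_R_fun:
  assumes "\<sigma> permutes {1..d}" "n \<le> card DV"
  defines "r \<equiv> perm_act \<sigma> (R_fun ord d x n)"
  shows "regular_at x r" "ratfun_eval x r \<noteq> 0"
    "rord (ratfun_eval x r) = (\<Sum>k=1..n. sum quad_ord (act \<sigma> ` top_pairs k))"
proof -
  have P: "act \<sigma> P \<in> quads d" if "m \<in> {1..n}" "P \<in> S_pairs ord d x m" for m P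
    using perm_act_cross_pair(3)[OF assms(1), of P] that S_pairs_eq[of m] assms(2) by auto
  note reg = eval_quad(1)[OF P] and nz = eval_quad(2)[OF P]
  show "regular_at x r" unfolding r_def perm_act_R_fun[OF assms(1,2)]
    by (intro ratfun_eval_prod_power(1) reg)
  have ev: "ratfun_eval x r =
      (\<Prod>m=1..n. \<Prod>P\<in>S_pairs ord d x m. ratfun_eval x (cross_pair (act \<sigma> P)) ^ (n - m + 1))"
    unfolding r_def perm_act_R_fun[OF assms(1,2)]
    by (intro ratfun_eval_prod_power(2) reg)
  have fin: "finite (S_pairs ord d x m)" if "m \<in> {1..n}" for m using finite_S_pairs that assms(2) by auto
  show "ratfun_eval x r \<noteq> 0" unfolding ev using nz fin by auto
  have "rord (ratfun_eval x r) = (\<Sum>m=1..n. real (n - m + 1) * (\<Sum>P\<in>S_pairs ord d x m. quad_ord (act \<sigma> P)))"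
  proof -
    have "rord (\<Prod>P\<in>S_pairs ord d x m. ratfun_eval x (cross_pair (act \<sigma> P)) ^ (n - m + 1)) =
        real (n - m + 1) * (\<Sum>P\<in>S_pairs ord d x m. quad_ord (act \<sigma> P))" if "m \<in> {1..n}" for m
    proof -
      have "rord (\<Prod>P\<in>S_pairs ord d x m. ratfun_eval x (cross_pair (act \<sigma> P)) ^ (n - m + 1)) =
          (\<Sum>P\<in>S_pairs ord d x m. rord (ratfun_eval x (cross_pair (act \<sigma> P)) ^ (n - m + 1)))"
        by (intro rord_prod power_not_zero nz[OF that])
      also have "\<dots> = (\<Sum>P\<in>S_pairs ord d x m. real (n - m + 1) * quad_ord (act \<sigma> P))"
        unfolding quad_ord_def by (intro sum.cong refl rord_power nz[OF that])
      finally show ?thesis by (simp only: sum_distrib_left)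
    qed
    moreover have "rord (ratfun_eval x r) =
        (\<Sum>m=1..n. rord (\<Prod>P\<in>S_pairs ord d x m. ratfun_eval x (cross_pair (act \<sigma> P)) ^ (n - m + 1)))"
      unfolding ev by (rule rord_prod) (use nz fin in auto)
    ultimately show ?thesis by simp
  qed
  also have "\<dots> = (\<Sum>k=1..n. \<Sum>P\<in>top_pairs k. quad_ord (act \<sigma> P))"
    by (rule weighted_sum_S_pairs[OF assms(2)])
  also have "\<dots> = (\<Sum>k=1..n. sum quad_ord (act \<sigma> ` top_pairs k))"
    using inj_act[OF assms(1)] by (simp add: sum.reindex inj_on_subset)
  finally show "rord (ratfun_eval x r) = (\<Sum>k=1..n. sum quad_ord (act \<sigma> ` top_pairs k))" .
qed

text \<open>Recovers the levels from the sublevel sets, so that a permutation preserving the latter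
  preserves the former.\<close>

lemma top_pairs_diff:
  assumes "m \<in> {1..card DV}"
  shows "S_pairs ord d x m = top_pairs m - top_pairs (m - 1)"
proof -
  have "{1..m} = insert m {1..m - 1}" using assms by auto
  then have "top_pairs m = S_pairs ord d x m \<union> top_pairs (m - 1)" by (simp add: top_pairs_def)
  moreover have "S_pairs ord d x m \<inter> top_pairs (m - 1) = {}"
    unfolding top_pairs_def using S_pairs_disjoint[of m] assms by fastforce
  ultimately show ?thesis by blast
qed

lemma perm_act_R_fun_fixed:
  assumes "\<sigma> permutes {1..d}" "n \<le> card DV" "\<And>k. k \<in> {1..n} \<Longrightarrow> act \<sigma> ` top_pairs k = top_pairs k"
  shows "perm_act \<sigma> (R_fun ord d x n) = R_fun ord d x n"
proof -
  \<comment> \<open>Level \<open>0\<close>, the empty union, is included because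
    \<open>m - 1\<close> is \<open>0\<close> for \<open>m = 1\<close>.\<close>
  have top_pairs: "act \<sigma> ` top_pairs k = top_pairs k" if "k \<le> n" for k
    using assms(3)[of k] that by (cases "k = 0") (auto simp: top_pairs_def)
  have S: "act \<sigma> ` S_pairs ord d x m = S_pairs ord d x m" if "m \<in> {1..n}" for m
  proof -
    have "m - 1 \<le> n" "m \<le> n" "m \<in> {1..card DV}" using that assms(2) by auto
    then show ?thesis
      by (simp only: top_pairs_diff image_set_diff[OF inj_act[OF assms(1)]] top_pairs)
  qed
  have "(\<Prod>P\<in>S_pairs ord d x m. cross_pair (act \<sigma> P) ^ (n - m + 1)) =
      (\<Prod>P\<in>S_pairs ord d x m. cross_pair P ^ (n - m + 1))" if "m \<in> {1..n}" for m
    using prod.reindex[OF inj_on_subset[OF inj_act[OF assms(1)] subset_UNIV],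
        of "\<lambda>P. cross_pair P ^ (n - m + 1)" "S_pairs ord d x m"] S[OF that] by simp
  then show ?thesis unfolding perm_act_R_fun[OF assms(1,2)] unfolding R_fun_def by (rule prod.cong[OF refl])
qed

lemma rord_eval_perm_act_R_fun_less:
  assumes "\<sigma> permutes {1..d}" "n \<le> card DV" "perm_act \<sigma> (R_fun ord d x n) \<noteq> R_fun ord d x n"
  shows "(\<Sum>k=1..n. sum quad_ord (top_pairs k)) < rord (ratfun_eval x (perm_act \<sigma> (R_fun ord d x n)))"
proof -
  \<comment> \<open>Since \<open>R_fun\<close> is moved, some sublevel set must be moved; there the
    increase is strict, and elsewhere the sum does not drop.\<close>
  obtain k0 where k0: "k0 \<in> {1..n}" "act \<sigma> ` top_pairs k0 \<noteq> top_pairs k0"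
    using perm_act_R_fun_fixed[OF assms(1,2)] assms(3) by blast
  have less: "sum quad_ord (top_pairs k) < sum quad_ord (act \<sigma> ` top_pairs k)" if "k \<in> {1..n}" "act \<sigma> ` top_pairs k \<noteq> top_pairs k" for k
  proof -
    have top_pairs: "top_pairs k = {P \<in> quads d. quad_ord P \<le> - 2 * \<delta> k}" using top_pairs_eq that(1) assms(2) by simp
    have "act \<sigma> ` top_pairs k \<subseteq> quads d" using perm_act_cross_pair(3)[OF assms(1)] top_pairs by auto
    moreover have "card (act \<sigma> ` top_pairs k) = card (top_pairs k)"
      by (rule card_image) (rule inj_on_subset[OF inj_act[OF assms(1)] subset_UNIV])
    ultimately show ?thesis 
      using sum_level_set_less[OF finite_quads, of "act \<sigma> ` top_pairs k" d quad_ord "- 2 * \<delta> k", folded top_pairs] that(2)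
      by blast
  qed
  have "sum quad_ord (top_pairs k) \<le> sum quad_ord (act \<sigma> ` top_pairs k)" if "k \<in> {1..n}" for k
    by (cases "act \<sigma> ` top_pairs k = top_pairs k") (use less[OF that] in simp_all)
  then have "(\<Sum>k=1..n. sum quad_ord (top_pairs k)) < (\<Sum>k=1..n. sum quad_ord (act \<sigma> ` top_pairs k))"
    using less[OF k0] k0(1) by (intro sum_strict_mono_ex1) blast+
  then show ?thesis using eval_perm_act_R_fun(3)[OF assms(1,2)] by simp
qed

section \<open>The order of the sum over the orbit\<close>

theorem ord_Inv:
  assumes "n \<le> card DV"
  shows "ord (ratfun_eval x (Inv ord d x n)) =
    ereal (- 2 * (\<Sum>m=1..n. real (K_count ord d x m) * real (n + 1 - m) * \<delta> m))"
proof -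
  define Orb where "Orb = {perm_act \<sigma> (R_fun ord d x n) |\<sigma>. \<sigma> permutes {1..d}}"
  define r where "r = R_fun ord d x n"
  have id: "id permutes {1..d}" by (rule permutes_id)
  have rid: "perm_act id r = r" unfolding r_def by (rule perm_act_R_fun_fixed) (use id assms in auto)
  have "Orb = (\<lambda>\<sigma>. perm_act \<sigma> (R_fun ord d x n)) ` {\<sigma>. \<sigma> permutes {1..d}}" unfolding Orb_def by auto
  then have fin: "finite Orb" using finite_permutations[of "{1..d}"] by simp
  have rO: "r \<in> Orb" unfolding Orb_def
    by (intro CollectI exI[of _ id] conjI) (use rid id in \<open>simp_all add: r_def\<close>)
  have rv: "rord (ratfun_eval x r) = (\<Sum>k=1..n. sum quad_ord (top_pairs k))"
    using eval_perm_act_R_fun(3)[OF id assms] rid unfolding r_def by simp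
  have reg: "regular_at x s" "ratfun_eval x s \<noteq> 0" if "s \<in> Orb" for s
    using that eval_perm_act_R_fun(1,2)[OF _ assms] unfolding Orb_def by auto
  have "ratfun_eval x (Inv ord d x n) = (\<Sum>s\<in>Orb. ratfun_eval x s)"
    unfolding Inv_def Orb_def[symmetric] by (rule ratfun_eval_sum) (rule reg)
  \<comment> \<open>\<open>Orb\<close> is a set, so \<open>r\<close> occurs once in the sum, and its
    term cannot be cancelled by terms of larger order.\<close>
  moreover have "ord (\<Sum>s\<in>Orb. ratfun_eval x s) = ereal (rord (ratfun_eval x r))"
  proof (rule ord_sum_unique_min[OF fin rO])
    fix s assume s: "s \<in> Orb" "s \<noteq> r"
    then show "ratfun_eval x s \<noteq> 0 \<and> rord (ratfun_eval x r) < rord (ratfun_eval x s)"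
      using rord_eval_perm_act_R_fun_less[OF _ assms] reg(2) rv unfolding Orb_def r_def by auto
  qed (use reg rO in auto)
  moreover have "(\<Sum>k=1..n. sum quad_ord (top_pairs k)) = (\<Sum>m=1..n. real (n - m + 1) * sum quad_ord (S_pairs ord d x m))"
    using weighted_sum_S_pairs[OF assms] by simp
  moreover have "\<dots> = (\<Sum>m=1..n. - 2 * (real (K_count ord d x m) * real (n + 1 - m) * \<delta> m))"
  proof (rule sum.cong[OF refl])
    fix m assume m: "m \<in> {1..n}"
    then have "sum quad_ord (S_pairs ord d x m) = real (K_count ord d x m) * (- 2 * \<delta> m)"
      using S_pairs_eq[of m] assms by (simp add: K_count_def)
    then show "real (n - m + 1) * sum quad_ord (S_pairs ord d x m) =
        - 2 * (real (K_count ord d x m) * real (n + 1 - m) * \<delta> m)"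
      using m by (simp add: Suc_diff_le)
  qed
  ultimately show ?thesis using rv by (simp add: sum_distrib_left)
qed

end

theorem theorem5p2:
  fixes v :: "'k::field \<Rightarrow> ereal"
    and ord :: "'k alg_closure \<Rightarrow> ereal"
    and f :: "'k poly"
    and x :: "nat \<Rightarrow> 'k alg_closure"
    and g d n :: nat
  assumes "local_field v"
    and "odd (residue_char v)"
    and "valuation ord"
    and "\<forall>a. ord (to_ac a) = v a"
    and "2 \<le> g"
    and "d = 2 * g + 2"
    and "squarefree f"
    and "degree f = d"
    and "bij_betw x {1..d} {z. poly (map_poly to_ac f) z = 0}"
    and "\<not> potentially_good_reduction ord g f"
    and "1 \<le> n"
    and "n \<le> n_dist ord d x"
  shows "ord (ratfun_eval x (Inv ord d x n)) =
    ereal (- 2 * (\<Sum>m=1..n. real (K_count ord d x m) * real (n + 1 - m) * delta ord d x m))"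
proof -
  \<comment> \<open>\<open>bij_betw\<close> provides the injective labelling of the roots, and
    \<open>d = 2 * g + 2\<close> gives \<open>1 \<le> d\<close>.\<close>
  interpret labelled_roots ord d x
    by unfold_locales (use assms in \<open>auto simp: bij_betw_def\<close>)
  show ?thesis using ord_Inv assms(12) by (simp add: n_dist_def)
qed

end
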